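(* Let $\mathcal{F}=\{f_i\}_{i=1}^n$ be a frame for $\mathbb{C}^d$ with (positive definite) frame operator $S_{\mathcal{F}}$. Let $0<\delta<1$ and let $s>0$ satisfy $(1-\delta)^d\le s\le(1+\delta)^d$. Set $\lambda=(\log\lambda_i(S_{\mathcal{F}}))_{i=1}^d$ (a non-increasing vector), $$t=\log\Big(\frac{s\cdot\det S_{\mathcal{F}}}{(1-\delta)^d}\Big)\ge\operatorname{tr}\lambda\quad\text{and}\quad\varepsilon=\log\Big(\frac{1+\delta}{1-\delta}\Big)>0 .$$ Let $\rho=\rho_{(t,\varepsilon)}(\lambda,0)$ (see context) and let $\mu=\big((1-\delta)\,e^{\rho_i}\big)_{i=1}^d$, which is a non-increasing vector. Then: 1. There exists $V_0\cdot\mathcal{F}\in\mathcal{P}_{(s,\delta)}(\mathcal{F})$ such that $\lambda(S_{V_0\cdot\mathcal{F}})=\mu$. 2. For every $V\cdot\mathcal{F}\in\mathcal{P}_{(s,\delta)}(\mathcal{F})$ we have $$\prod_{i=1}^k\mu_i\le\prod_{i=1}^k\lambda_i(S_{V\cdot\mathcal{F}})\quad\text{for every }1\le k\le d.$$ 3. For $V\cdot\mathcal{F}\in\mathcal{P}_{(s,\delta)}(\mathcal{F})$, equality holds in item 2 for every $1\le k\le d$ (i.e. $\lambda(S_{V\cdot\mathcal{F}})=\mu$) if and only if $\det(V^*V)=s$ and there exists an orthonormal basis $\{v_i\}_{i=1}^d$ of $\mathbb{C}^d$ such that $$S_{\mathcal{F}}=\sum_{i=1}^d\lambda_i(S_{\mathcal{F}})\,v_i\otimes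 v_i\quad\text{and}\quad VV^*=\sum_{i=1}^d\frac{\mu_i}{\lambda_i(S_{\mathcal{F}})}\,v_i\otimes v_i .$$
   Context: For a finite sequence $\mathcal{F}=\{f_i\}_{i=1}^n$ in $\mathbb{C}^d$, the frame operator is $S_{\mathcal{F}}=\sum_{i=1}^n f_i\otimes f_i$, where $(x\otimes y)(z)=\langle z,y\rangle x$. $\mathcal{F}$ is a frame for $\mathbb{C}^d$ iff it spans $\mathbb{C}^d$. For an invertible $d\times d$ complex matrix $V$, $V\cdot\mathcal{F}=\{Vf_i\}_{i=1}^n$, and $$\mathcal{P}_{(s,\delta)}(\mathcal{F})=\{V\cdot\mathcal{F}:\ V\text{ invertible},\ \|V^*V-I\|\le\delta,\ \det(V^*V)\ge s\}$$ with $\|\cdot\|$ the spectral norm. For a positive semidefinite $d\times d$ matrix $S$, $\lambda(S)=(\lambda_i(S))_{i=1}^d$ is the vector of eigenvalues counted with multiplicity in non-increasing order. For $x\in\mathbb{R}^d$, $x^\downarrow$ (resp. $x^\uparrow$) is its rearrangement in non-increasing (resp. non-decreasing) order and $\operatorname{tr}x=\sum_i x_i$. Submajorization: $x\prec_w y$ means $\sum_{i=1}^k x_i^\downarrow\le\sum_{i=1}^k y_i^\downarrow$ for all $1\le k\le d$. For $\lambda\in\mathbb{R}^d$ with $\lambda=\lambda^\downarrow$, $\varepsilon>0$ and $t\ge\operatorname{tr}\lambda$ with $t-\operatorname{tr}\lambda\le d\cdot\varepsilon$, let $$\Lambda_{(t,\varepsilon)}(\lambda,0)=\{\lambda+\mu:\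 \mu\in\mathbb{R}^d,\ 0\le\mu_i\le\varepsilon\ \forall i,\ \operatorname{tr}\mu\ge t-\operatorname{tr}\lambda\}.$$ The vector $\rho_{(t,\varepsilon)}(\lambda,0)$ denotes the unique $\rho\in\Lambda_{(t,\varepsilon)}(\lambda,0)$ such that $\operatorname{tr}\rho=t$, $\rho\prec_w\gamma$ for every $\gamma\in\Lambda_{(t,\varepsilon)}(\lambda,0)$, and $\rho-\lambda=(\rho-\lambda)^\uparrow$ (such a $\rho$ exists, is unique, and is itself non-increasing).
   Formalization: In item 3 the decomposition is stated for V*V instead of VV*: with VV* both implications fail, e.g. d=2, F=(√2e₁,e₂), δ=s=1/2, with V=P·diag(√½,1) for "only if" and V=diag(√½,1)·P for "if" (P the coordinate swap). *)

theory Defs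
  imports
    Complex_Main
    "Jordan_Normal_Form.Char_Poly"
    "Jordan_Normal_Form.Schur_Decomposition"
    "Jordan_Normal_Form.VS_Connect"
begin

text \<open>
  Finite sequences in \<open>C^d\<close> are lists of vectors in \<^term>\<open>carrier_vec d\<close>; vectors in
  \<open>R^d\<close> are real lists of length \<open>d\<close>.  All indices start at \<open>0\<close>.
  The inner product \<open>\<langle>x, y\<rangle>\<close> is \<open>x \<bullet>c y\<close>, linear in its first argument.
\<close>

section \<open>Vectors and matrices over the complex numbers\<close>

definition outer :: "complex vec \<Rightarrow> complex vec \<Rightarrow> complex mat" where
  "outer x y = mat (dim_vec x) (dim_vec y) (\<lambda>(i, j). x $ i * cnj (y $ j))"

lemma outer_mult_vec:
  assumes "x \<in> carrier_vec d" and "y \<in> carrier_vec d" and "z \<in> carrier_vec d"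
  shows "outer x y *\<^sub>v z = (z \<bullet>c y) \<cdot>\<^sub>v x"
  using assms
  by (intro eq_vecI)
    (auto simp: outer_def scalar_prod_def sum_distrib_left sum_distrib_right mult_ac)

text \<open>The sum of the \<open>d \<times> d\<close> matrices \<open>A 0, \<dots>, A (n - 1)\<close>.\<close>

definition mat_sum :: "nat \<Rightarrow> nat \<Rightarrow> (nat \<Rightarrow> complex mat) \<Rightarrow> complex mat" where
  "mat_sum d n A = mat d d (\<lambda>(i, j). \<Sum>k<n. A k $$ (i, j))"

definition vnorm :: "complex vec \<Rightarrow> real" where
  "vnorm x = sqrt (Re (x \<bullet>c x))"

definition spectral_norm :: "complex mat \<Rightarrow> real" where
  "spectral_norm A = (SUP x \<in> {x \<in> carrier_vec (dim_col A). vnorm x \<le> 1}. vnorm (A *\<^sub>v x))"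

definition orthonormal_basis :: "nat \<Rightarrow> complex vec list \<Rightarrow> bool" where
  "orthonormal_basis d vs \<longleftrightarrow> length vs = d \<and> set vs \<subseteq> carrier_vec d \<and>
     (\<forall>i<d. \<forall>j<d. vs ! i \<bullet>c vs ! j = (if i = j then 1 else 0))"

text \<open>
  The roots of the characteristic polynomial, with multiplicity, in non-increasing order.
  Only used for positive semidefinite matrices, whose eigenvalues are real.
\<close>

definition eigvals_desc :: "complex mat \<Rightarrow> real list" where
  "eigvals_desc S = rev (sorted_list_of_multiset (image_mset Re (proots (char_poly S))))"

section \<open>Frames and their perturbations\<close>

definition is_frame :: "nat \<Rightarrow> complex vec list \<Rightarrow> bool" where
  "is_frame d F \<longleftrightarrow> set F \<subseteq> carrier_vec d \<and>
     LinearCombinations.module.span class_ring (module_vec TYPE(complex) d) (set F) = carrier_vec d"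

definition frame_op :: "nat \<Rightarrow> complex vec list \<Rightarrow> complex mat" where
  "frame_op d F = mat_sum d (length F) (\<lambda>k. outer (F ! k) (F ! k))"

definition act :: "complex mat \<Rightarrow> complex vec list \<Rightarrow> complex vec list" where
  "act V F = map (\<lambda>f. V *\<^sub>v f) F"

text \<open>The determinant of \<open>V\<^sup>* V\<close> is a nonnegative real, so \<^const>\<open>Re\<close> loses nothing.\<close>

definition perturbations ::
    "nat \<Rightarrow> real \<Rightarrow> real \<Rightarrow> complex vec list \<Rightarrow> complex vec list set" where
  "perturbations d s \<delta> F = {act V F | V. V \<in> carrier_mat d d \<and> invertible_mat V \<and>
     spectral_norm (mat_adjoint V * V - 1\<^sub>m d) \<le> \<delta> \<and> s \<le> Re (det (mat_adjoint V * V))}"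

section \<open>Submajorization and the optimal vector\<close>

definition incr :: "real list \<Rightarrow> real list" where
  "incr x = sort x"

definition decr :: "real list \<Rightarrow> real list" where
  "decr x = rev (sort x)"

definition submajorized :: "real list \<Rightarrow> real list \<Rightarrow> bool" (infix "\<prec>\<^sub>w" 50) where
  "x \<prec>\<^sub>w y \<longleftrightarrow> length x = length y \<and>
     (\<forall>k \<in> {1..length x}. (\<Sum>i<k. decr x ! i) \<le> (\<Sum>i<k. decr y ! i))"

definition Lambda_set :: "real \<Rightarrow> real \<Rightarrow> real list \<Rightarrow> real list set" where
  "Lambda_set t \<epsilon> lam = {map2 (+) lam \<mu> | \<mu>. length \<mu> = length lam \<and>
     (\<forall>i<length lam. 0 \<le> \<mu> ! i \<and> \<mu> ! i \<le> \<epsilon>) \<and> t - sum_list lam \<le> sum_list \<mu>}"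

text \<open>
  Well defined if \<open>lam\<close> is non-increasing, \<open>\<epsilon> > 0\<close> and
  \<open>0 \<le> t - sum_list lam \<le> length lam * \<epsilon>\<close>.
\<close>

definition rho :: "real \<Rightarrow> real \<Rightarrow> real list \<Rightarrow> real list" where
  "rho t \<epsilon> lam = (THE \<rho>. \<rho> \<in> Lambda_set t \<epsilon> lam \<and> sum_list \<rho> = t \<and>
     (\<forall>\<gamma> \<in> Lambda_set t \<epsilon> lam. \<rho> \<prec>\<^sub>w \<gamma>) \<and>
     map2 (-) \<rho> lam = incr (map2 (-) \<rho> lam))"

text \<open>
  A caveat on the equality case: as \<open>S\<^bsub>V\<cdot>F\<^esub> = V S\<^bsub>F\<^esub> V\<^sup>*\<close>, its eigenvalues do not change when
  \<open>V\<close> is replaced by \<open>U V\<close> with \<open>U\<close> unitary.  Hence they can determine \<open>V\<^sup>* V\<close>, but not \<open>V V\<^sup>*\<close>,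
  and the spectral decomposition with respect to an eigenbasis of \<open>S\<^bsub>F\<^esub>\<close> is stated for \<open>V\<^sup>* V\<close>;
  with \<open>V V\<^sup>*\<close> in its place both implications fail already for \<open>d = 2\<close>.
\<close>

end

theory Submission
  imports Defs
begin

text \<open>
  Put \<open>S = frame_op d F\<close>, with eigenvalues \<open>a\<close> in non-increasing order, and
  \<open>P = V\<^sup>* V\<close>.  The frame operator of \<open>V \<cdot> F\<close> is \<open>V S V\<^sup>*\<close>, and \<open>V\<close> is admissible exactly if \<open>V\<close> is
  invertible, \<open>(1 - \<delta>) I \<le> P \<le> (1 + \<delta>) I\<close> and \<open>det P \<ge> s\<close>.

  \<^item> The vector \<open>rho t \<epsilon> lam\<close> is explicit: it is \<open>lam\<close> raised to a common water level \<open>c\<close>, each entry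
    moving up by at most \<open>\<epsilon>\<close>, that is, \<open>c\<close> clamped to \<open>[lam ! i, lam ! i + \<epsilon>]\<close>
    (\<open>rho_eq_water_fill\<close>).  The level exists by the intermediate value theorem.  Against a
    non-increasing competitor the difference changes sign at most once, from \<open>+\<close> to \<open>-\<close>, so that
    its partial sums are nonnegative as soon as its total is.

  \<^item> Minimality.  If \<open>g\<close> lists the eigenvalues of \<open>V S V\<^sup>*\<close>, then
    \<open>(1 - \<delta>) a\<^sub>i \<le> g\<^sub>i \<le> (1 + \<delta>) a\<^sub>i\<close> by the min-max principle
    (\<open>congruence_eigenvalue_bounds\<close>), and \<open>\<Prod> g\<^sub>i = det P \<cdot> \<Prod> a\<^sub>i \<ge> s \<cdot> \<Prod> a\<^sub>i\<close>.  In other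
    words, the vector of the \<open>ln (g\<^sub>i / (1 - \<delta>))\<close> is a member of \<open>Lambda_set t \<epsilon> lam\<close>; that it
    submajorizes \<open>rho t \<epsilon> lam\<close> is the claimed inequality of products.

  \<^item> Attainment.  In an eigenbasis of \<open>S\<close> take \<open>V\<close> diagonal with entries \<open>\<surd>(\<mu>\<^sub>i / a\<^sub>i)\<close>.

  \<^item> Equality (\<open>congruence_rigidity\<close>).  Let \<open>Q\<close> be the matrix of \<open>P\<close> in an eigenbasis of \<open>S\<close>, and put
    \<open>b\<^sub>i = a\<^sub>i Q\<^sub>i\<^sub>i\<close>.  If \<open>V S V\<^sup>*\<close> has the eigenvalues \<open>\<mu>\<close>, then the traces of \<open>S P\<close> and of
    \<open>(S P)\<^sup>2\<close> give \<open>\<Sum> b\<^sub>i = \<Sum> \<mu>\<^sub>i\<close> and \<open>\<Sum> a\<^sub>i a\<^sub>j |Q\<^sub>i\<^sub>j|\<^sup>2 = \<Sum> \<mu>\<^sub>i\<^sup>2\<close>.  But \<open>\<mu>\<close> is a clamped constant,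
    and among all vectors that obey the same bounds and have the same sum such a vector has the
    strictly smallest sum of squares (\<open>sum_squares_water_level\<close>).  As the \<open>b\<^sub>i\<^sup>2\<close> are the diagonal
    part of the second sum, \<open>b = \<mu>\<close> and all off-diagonal entries of \<open>Q\<close> vanish.  So every
    eigenbasis of \<open>S\<close> with the eigenvalues in order diagonalizes \<open>P\<close>.  Conversely,
    \<open>V S V\<^sup>*\<close> is similar to \<open>S P\<close>, whose eigenvalues are \<open>\<mu>\<close> if \<open>S\<close> and \<open>P\<close> have the stated form.
    The inequality for sums of squares also gives the uniqueness of \<open>rho\<close>.
\<close>

section \<open>Water-filling and submajorization\<close>

text \<open>
  Expand \<open>b\<^sup>2 = u\<^sup>2 + (b - u)\<^sup>2 + 2 u (b - u)\<close>.  As \<open>b - u\<close> sums to zero, \<open>u\<close> may be replaced by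
  \<open>u - c\<close> in the mixed term, and then each summand \<open>(u - c) (b - u)\<close> is nonnegative: the constraints
  say that its factors never have opposite signs.
\<close>

lemma sum_squares_water_level:
  fixes u b :: "nat \<Rightarrow> real"
  assumes above: "\<And>i. i < d \<Longrightarrow> c < u i \<Longrightarrow> u i \<le> b i"
    and below: "\<And>i. i < d \<Longrightarrow> u i < c \<Longrightarrow> b i \<le> u i"
    and sums: "(\<Sum>i<d. b i) = (\<Sum>i<d. u i)"
  shows "(\<Sum>i<d. (u i)\<^sup>2) + (\<Sum>i<d. (b i - u i)\<^sup>2) \<le> (\<Sum>i<d. (b i)\<^sup>2)"
proof -
  have "0 \<le> (\<Sum>i<d. (u i - c) * (b i - u i))"
  proof (rule sum_nonneg)
    fix i assume "i \<in> {..<d}"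
    then show "0 \<le> (u i - c) * (b i - u i)"
      using above[of i] below[of i]
      by (cases "u i" c rule: linorder_cases) (auto intro: mult_nonpos_nonpos)
  qed
  also have "\<dots> = (\<Sum>i<d. u i * (b i - u i)) - c * (\<Sum>i<d. b i - u i)"
    by (simp add: left_diff_distrib sum_subtractf sum_distrib_left right_diff_distrib)
  also have "(\<Sum>i<d. b i - u i) = 0"
    using sums by (simp add: sum_subtractf)
  finally have cross: "0 \<le> (\<Sum>i<d. u i * (b i - u i))"
    by simp
  have "(\<Sum>i<d. (b i)\<^sup>2) = (\<Sum>i<d. (u i)\<^sup>2 + (b i - u i)\<^sup>2 + 2 * (u i * (b i - u i)))"
    by (rule sum.cong) (auto simp: power2_eq_square algebra_simps)
  also have "\<dots> = (\<Sum>i<d. (u i)\<^sup>2) + (\<Sum>i<d. (b i - u i)\<^sup>2) + 2 * (\<Sum>i<d. u i * (b i - u i))"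
    by (simp only: sum.distrib sum_distrib_left)
  finally show ?thesis
    using cross by linarith
qed

text \<open>
  Once \<open>g\<close> has dropped below \<open>u\<close> it never exceeds \<open>u\<close> again, so a negative partial sum of \<open>g - u\<close> could never
  recover to the nonnegative total.
\<close>

lemma partial_sums_le_if_single_crossing:
  fixes u g :: "nat \<Rightarrow> real"
  assumes crossing: "\<And>i j. i < j \<Longrightarrow> j < d \<Longrightarrow> g i < u i \<Longrightarrow> g j \<le> u j"
    and total: "(\<Sum>i<d. u i) \<le> (\<Sum>i<d. g i)" and k: "k \<le> d"
  shows "(\<Sum>i<k. u i) \<le> (\<Sum>i<k. g i)"
proof (rule ccontr)
  assume *: "\<not> ?thesis"
  then obtain i where i: "i < k" "g i < u i"
    by (meson lessThan_iff not_le sum_mono)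
  have "(\<Sum>j\<in>{k..<d}. g j) \<le> (\<Sum>j\<in>{k..<d}. u j)"
    using i by (intro sum_mono) (auto intro: crossing[of i])
  moreover have "(\<Sum>j<d. f j) = (\<Sum>j<k. f j) + (\<Sum>j\<in>{k..<d}. f j)" for f :: "nat \<Rightarrow> real"
    using k by (metis atLeast0LessThan le0 sum.atLeastLessThan_concat)
  ultimately show False
    using * total by (smt (verit))
qed

lemma length_decr [simp]: "length (decr x) = length x"
  by (simp add: decr_def)

lemma mset_decr [simp]: "mset (decr x) = mset x"
  by (simp add: decr_def)

lemma sum_list_decr [simp]: "sum_list (decr x) = sum_list x"
  by (metis mset_decr sum_mset_sum_list)

lemma decr_cong_mset: "mset x = mset y \<Longrightarrow> decr x = decr y"
  unfolding decr_def by (metis properties_for_sort sorted_sort mset_sort)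

lemma decr_eq_iff:
  "decr x = x \<longleftrightarrow> (\<forall>i j. i \<le> j \<longrightarrow> j < length x \<longrightarrow> x ! j \<le> x ! i)"
proof -
  have "decr x = x \<longleftrightarrow> sorted (rev x)"
    by (metis decr_def mset_rev rev_rev_ident sort_key_id_if_sorted sorted_sort properties_for_sort)
  also have "\<dots> \<longleftrightarrow> (\<forall>i j. i \<le> j \<longrightarrow> j < length x \<longrightarrow> x ! j \<le> x ! i)"
    by (auto simp: sorted_rev_iff_nth_mono)
  finally show ?thesis .
qed

lemma decr_antimono: "i \<le> j \<Longrightarrow> j < length x \<Longrightarrow> decr x ! j \<le> decr x ! i"
  using decr_eq_iff[of "decr x"] decr_cong_mset[of "decr x" x] by simp

text \<open>
  Counting the entries above a threshold turns statements about the sorted list into statements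
  about the unsorted one; this is what makes sorting monotone.
\<close>

lemma decr_le_iff:
  assumes "i < length x"
  shows "decr x ! i \<le> v \<longleftrightarrow> length (filter (\<lambda>z. v < z) x) \<le> i"
proof -
  have len: "length (filter (\<lambda>z. v < z) (decr x)) = length (filter (\<lambda>z. v < z) x)"
    by (metis mset_decr mset_filter size_mset)
  have card: "length (filter (\<lambda>z. v < z) (decr x)) = card {j. j < length x \<and> v < decr x ! j}"
    by (simp add: length_filter_conv_card)
  show ?thesis
  proof
    assume *: "decr x ! i \<le> v"
    have "{j. j < length x \<and> v < decr x ! j} \<subseteq> {..<i}"
      using decr_antimono[of i _ x] * by (force simp: not_less[symmetric])
    then have "card {j. j < length x \<and> v < decr x ! j} \<le> card {..<i}"
      by (intro card_mono) auto
    then show "length (filter (\<lambda>z. v < z) x) \<le> i"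
      using len card by simp
  next
    assume *: "length (filter (\<lambda>z. v < z) x) \<le> i"
    show "decr x ! i \<le> v"
    proof (rule ccontr)
      assume "\<not> decr x ! i \<le> v"
      then have "{..i} \<subseteq> {j. j < length x \<and> v < decr x ! j}"
        using decr_antimono[of _ i x] assms by force
      then have "card {..i} \<le> card {j. j < length x \<and> v < decr x ! j}"
        by (intro card_mono) auto
      then show False
        using * len card by simp
    qed
  qed
qed

lemma decr_mono:
  assumes "length x = length y" and "\<And>i. i < length x \<Longrightarrow> x ! i \<le> y ! i" and "i < length x"
  shows "decr x ! i \<le> decr y ! i"
proof -
  have "{j. j < length x \<and> decr y ! i < x ! j} \<subseteq> {j. j < length y \<and> decr y ! i < y ! j}"
    using assms(1,2) by force
  then have "length (filter (\<lambda>z. decr y ! i < z) x) \<le> length (filter (\<lambda>z. decr y ! i < z) y)"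
    by (simp add: length_filter_conv_card card_mono)
  also have "\<dots> \<le> i"
    using decr_le_iff[of i y "decr y ! i"] assms by simp
  finally show ?thesis
    using decr_le_iff[of i x] assms(3) by simp
qed

text \<open>
  The level \<open>c\<close> clamped to the intervals \<open>[lam ! i, lam ! i + \<epsilon>]\<close>.
\<close>

definition water_fill :: "real \<Rightarrow> real \<Rightarrow> real list \<Rightarrow> real list" where
  "water_fill c \<epsilon> lam = map (\<lambda>l. max l (min c (l + \<epsilon>))) lam"

lemma length_water_fill [simp]: "length (water_fill c \<epsilon> lam) = length lam"
  by (simp add: water_fill_def)

lemma water_fill_nth:
  "i < length lam \<Longrightarrow> water_fill c \<epsilon> lam ! i = max (lam ! i) (min c (lam ! i + \<epsilon>))"
  by (simp add: water_fill_def)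

lemma decr_water_fill:
  assumes "decr lam = lam"
  shows "decr (water_fill c \<epsilon> lam) = water_fill c \<epsilon> lam"
  using assms unfolding decr_eq_iff
  by (fastforce simp: water_fill_nth intro: max.mono min.mono)

lemma sum_list_nth_lessThan: "sum_list (x :: real list) = (\<Sum>i<length x. x ! i)"
  by (simp add: sum_list_sum_nth atLeast0LessThan)

text \<open>
  The total is continuous in the level; a very low level leaves \<open>lam\<close> unchanged, a very high one
  lifts every entry by \<open>\<epsilon>\<close>.
\<close>

lemma ex_water_level:
  assumes "0 < \<epsilon>" and "sum_list lam \<le> t" and "t \<le> sum_list lam + real (length lam) * \<epsilon>"
  shows "\<exists>c. sum_list (water_fill c \<epsilon> lam) = t"
proof -
  define f where "f c = (\<Sum>i<length lam. max (lam ! i) (min c (lam ! i + \<epsilon>)))" for c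
  have f: "sum_list (water_fill c \<epsilon> lam) = f c" for c
    by (simp add: f_def sum_list_nth_lessThan water_fill_nth)
  define m where "m = (\<Sum>i<length lam. \<bar>lam ! i\<bar>)"
  have m: "\<bar>lam ! i\<bar> \<le> m" if "i < length lam" for i
    unfolding m_def using that by (intro member_le_sum) auto
  have "f (- m) = sum_list lam"
    unfolding f_def sum_list_nth_lessThan
  proof (rule sum.cong)
    fix i assume "i \<in> {..<length lam}"
    then show "max (lam ! i) (min (- m) (lam ! i + \<epsilon>)) = lam ! i"
      using m[of i] by auto
  qed simp
  moreover have "f (m + \<epsilon>) = (\<Sum>i<length lam. lam ! i + \<epsilon>)"
    unfolding f_def
  proof (rule sum.cong)
    fix i assume "i \<in> {..<length lam}"
    then show "max (lam ! i) (min (m + \<epsilon>) (lam ! i + \<epsilon>)) = lam ! i + \<epsilon>"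
      using m[of i] assms(1) by auto
  qed simp
  moreover have "(\<Sum>i<length lam. lam ! i + \<epsilon>) = sum_list lam + real (length lam) * \<epsilon>"
    by (simp add: sum.distrib sum_list_nth_lessThan)
  moreover have "- m \<le> m + \<epsilon>"
    using assms(1) unfolding m_def by (smt (verit) sum_nonneg abs_ge_zero)
  moreover have "continuous_on {- m..m + \<epsilon>} f"
    unfolding f_def by (intro continuous_intros)
  ultimately obtain c where "f c = t"
    using IVT'[of f "- m" t "m + \<epsilon>"] assms by auto
  then show ?thesis
    using f by blast
qed

lemma Lambda_set_iff:
  "\<gamma> \<in> Lambda_set t \<epsilon> lam \<longleftrightarrow> length \<gamma> = length lam \<and>
     (\<forall>i<length lam. lam ! i \<le> \<gamma> ! i \<and> \<gamma> ! i \<le> lam ! i + \<epsilon>) \<and> t \<le> sum_list \<gamma>"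
proof (intro iffI)
  assume "\<gamma> \<in> Lambda_set t \<epsilon> lam"
  then show "length \<gamma> = length lam \<and>
     (\<forall>i<length lam. lam ! i \<le> \<gamma> ! i \<and> \<gamma> ! i \<le> lam ! i + \<epsilon>) \<and> t \<le> sum_list \<gamma>"
    unfolding Lambda_set_def
    by (auto simp: sum_list_nth_lessThan sum.distrib algebra_simps)
next
  assume *: "length \<gamma> = length lam \<and>
     (\<forall>i<length lam. lam ! i \<le> \<gamma> ! i \<and> \<gamma> ! i \<le> lam ! i + \<epsilon>) \<and> t \<le> sum_list \<gamma>"
  have "\<gamma> = map2 (+) lam (map2 (-) \<gamma> lam)"
    using * by (auto intro!: nth_equalityI)
  moreover have "t - sum_list lam \<le> sum_list (map2 (-) \<gamma> lam)"
    using * by (auto simp: sum_list_nth_lessThan sum_subtractf)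
  ultimately show "\<gamma> \<in> Lambda_set t \<epsilon> lam"
    unfolding Lambda_set_def using *
    by (auto simp: algebra_simps intro!: exI[of _ "map2 (-) \<gamma> lam"])
qed

text \<open>
  A member \<open>\<gamma>\<close> of the set need not be sorted, but its decreasing rearrangement obeys the same bounds,
  because sorting is monotone and both bounds are sorted already.  Against that rearrangement the
  water-filled vector satisfies the single crossing condition.
\<close>

lemma water_fill_submajorized:
  assumes lam: "decr lam = lam" and "0 < \<epsilon>" and sum: "sum_list (water_fill c \<epsilon> lam) = t"
    and \<gamma>: "\<gamma> \<in> Lambda_set t \<epsilon> lam"
  shows "water_fill c \<epsilon> lam \<prec>\<^sub>w \<gamma>"
proof -
  define g where "g = decr \<gamma>"
  define u where "u = water_fill c \<epsilon> lam"
  define n where "n = length lam"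
  have n: "length \<gamma> = n" "length g = n" "length u = n"
    using \<gamma> by (auto simp: n_def Lambda_set_iff g_def u_def)
  have lower: "lam ! i \<le> g ! i" if "i < n" for i
    using decr_mono[of lam \<gamma> i] \<gamma> that lam by (auto simp: Lambda_set_iff g_def n_def)
  have upper: "g ! i \<le> lam ! i + \<epsilon>" if "i < n" for i
  proof -
    have "decr (map (\<lambda>l. l + \<epsilon>) lam) = map (\<lambda>l. l + \<epsilon>) lam"
      using lam unfolding decr_eq_iff by auto
    then show ?thesis
      using decr_mono[of \<gamma> "map (\<lambda>l. l + \<epsilon>) lam" i] \<gamma> that n
      by (auto simp: Lambda_set_iff g_def n_def)
  qed
  have u: "u ! i = max (lam ! i) (min c (lam ! i + \<epsilon>))" if "i < n" for i
    using that by (simp add: u_def n_def water_fill_nth)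
  have mono_g: "g ! j \<le> g ! i" if "i \<le> j" "j < n" for i j
    using that n decr_antimono by (simp add: g_def)
  have mono_u: "u ! j \<le> u ! i" if "i \<le> j" "j < n" for i j
    using that n decr_water_fill[OF lam, of c \<epsilon>] unfolding decr_eq_iff u_def by simp
  have "(\<Sum>i<k. u ! i) \<le> (\<Sum>i<k. g ! i)" if "k \<le> n" for k
  proof (rule partial_sums_le_if_single_crossing)
    show "(\<Sum>i<n. u ! i) \<le> (\<Sum>i<n. g ! i)"
      using \<gamma> sum n sum_list_nth_lessThan[of u] sum_list_nth_lessThan[of g]
      by (simp add: Lambda_set_iff g_def u_def)
    fix i j assume ij: "i < j" "j < n" "g ! i < u ! i"
    \<comment> \<open>An entry \<open>u ! i\<close> above the level \<open>c\<close> equals \<open>lam ! i \<le> g ! i\<close>; so \<open>u ! i \<le> c\<close> here.\<close>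
    have "g ! i < c" "u ! i \<le> c"
      using ij lower[of i] u[of i] by auto
    then show "g ! j \<le> u ! j"
      using ij mono_g[of i j] u[of j] upper[of j] by auto
  qed (fact that)
  then show ?thesis
    using n decr_water_fill[OF lam, of c \<epsilon>]
    by (auto simp: submajorized_def g_def[symmetric] u_def[symmetric])
qed

lemma submajorized_antisym:
  assumes "x \<prec>\<^sub>w y" and "y \<prec>\<^sub>w x"
  shows "mset x = mset y"
proof -
  have len: "length x = length y"
    using assms(1) by (simp add: submajorized_def)
  have sums: "(\<Sum>i<k. decr x ! i) = (\<Sum>i<k. decr y ! i)" if "k \<le> length x" for k
    using assms that len
    by (cases "k = 0") (auto simp: submajorized_def intro!: order_antisym)
  have "decr x ! i = decr y ! i" if "i < length x" for i
    using sums[of "Suc i"] sums[of i] that by simp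
  then have "decr x = decr y"
    using len by (intro nth_equalityI) auto
  then show ?thesis
    by (metis mset_decr)
qed

text \<open>
  For uniqueness, two minimal vectors submajorize each other and hence are rearrangements of one
  another.  In particular their sums and their sums of squares agree, and then
  \<open>sum_squares_water_level\<close> forces them to be equal.
\<close>

lemma rho_eq_water_fill:
  assumes lam: "decr lam = lam" and \<epsilon>: "0 < \<epsilon>" and sum: "sum_list (water_fill c \<epsilon> lam) = t"
  shows "rho t \<epsilon> lam = water_fill c \<epsilon> lam"
  unfolding rho_def
proof (rule the_equality)
  let ?u = "water_fill c \<epsilon> lam"
  have mem: "?u \<in> Lambda_set t \<epsilon> lam"
    using sum \<epsilon> by (auto simp: Lambda_set_iff water_fill_nth)
  have "sorted (map2 (-) ?u lam)"
    using lam unfolding decr_eq_iff sorted_iff_nth_mono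
    by (fastforce simp: water_fill_nth max_def min_def)
  then show "?u \<in> Lambda_set t \<epsilon> lam \<and> sum_list ?u = t \<and>
      (\<forall>\<gamma>\<in>Lambda_set t \<epsilon> lam. ?u \<prec>\<^sub>w \<gamma>) \<and> map2 (-) ?u lam = incr (map2 (-) ?u lam)"
    using mem sum water_fill_submajorized[OF lam \<epsilon> sum] by (simp add: incr_def sorted_sort_id)
  fix r
  assume r: "r \<in> Lambda_set t \<epsilon> lam \<and> sum_list r = t \<and>
      (\<forall>\<gamma>\<in>Lambda_set t \<epsilon> lam. r \<prec>\<^sub>w \<gamma>) \<and> map2 (-) r lam = incr (map2 (-) r lam)"
  let ?n = "length lam"
  have len: "length r = ?n"
    using r by (simp add: Lambda_set_iff)
  have "mset r = mset ?u"
    using r mem water_fill_submajorized[OF lam \<epsilon> sum] by (intro submajorized_antisym) auto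
  then have "sum_list (map (\<lambda>z. z\<^sup>2) r) = sum_list (map (\<lambda>z. z\<^sup>2) ?u)"
    by (metis mset_map sum_mset_sum_list)
  then have squares: "(\<Sum>i<?n. (r ! i)\<^sup>2) = (\<Sum>i<?n. (?u ! i)\<^sup>2)"
    using len by (simp add: sum_list_nth_lessThan)
  have "(\<Sum>i<?n. (?u ! i)\<^sup>2) + (\<Sum>i<?n. (r ! i - ?u ! i)\<^sup>2) \<le> (\<Sum>i<?n. (r ! i)\<^sup>2)"
    using r sum len \<epsilon> sum_list_nth_lessThan[of r] sum_list_nth_lessThan[of ?u]
    by (intro sum_squares_water_level[where c = c])
      (auto simp: Lambda_set_iff water_fill_nth max_def min_def split: if_splits)
  then have "(\<Sum>i<?n. (r ! i - ?u ! i)\<^sup>2) = 0"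
    using squares sum_nonneg[of "{..<?n}" "\<lambda>i. (r ! i - ?u ! i)\<^sup>2"] by simp
  then have "\<forall>i<?n. r ! i = ?u ! i"
    by (simp add: sum_nonneg_eq_0_iff)
  then show "r = ?u"
    using len by (intro nth_equalityI) auto
qed

section \<open>Adjoints, norms and unitary matrices\<close>

lemma adjoint_dim [simp]:
  "dim_row (mat_adjoint A) = dim_col A" "dim_col (mat_adjoint A) = dim_row A"
  by (simp_all add: mat_adjoint_def)

lemma adjoint_carrier [simp]: "A \<in> carrier_mat m n \<Longrightarrow> mat_adjoint A \<in> carrier_mat n m"
  by (intro carrier_matI) (simp_all add: carrier_matD)

lemma mult_carrier_square [simp]:
  "A \<in> carrier_mat d d \<Longrightarrow> B \<in> carrier_mat d d \<Longrightarrow> A * B \<in> carrier_mat d d"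
  by (rule mult_carrier_mat)

lemma mult_vec_carrier_square [simp]:
  "A \<in> carrier_mat d d \<Longrightarrow> x \<in> carrier_vec d \<Longrightarrow> A *\<^sub>v x \<in> carrier_vec d"
  by (rule mult_mat_vec_carrier)

lemma adjoint_index [simp]:
  "i < dim_col A \<Longrightarrow> j < dim_row A \<Longrightarrow> mat_adjoint A $$ (i, j) = conjugate (A $$ (j, i))"
  by (simp add: mat_adjoint_def mat_of_rows_index)

lemma adjoint_adjoint [simp]: "mat_adjoint (mat_adjoint A) = A"
  by (rule eq_matI) auto

lemma adjoint_one [simp]: "mat_adjoint (1\<^sub>m d :: complex mat) = 1\<^sub>m d"
  by (rule eq_matI) auto

lemma mat_diag_dims [simp]: "dim_row (mat_diag d f) = d" "dim_col (mat_diag d f) = d"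
  by (simp_all add: mat_diag_def)

lemma adjoint_mult:
  fixes A B :: "complex mat"
  assumes "A \<in> carrier_mat m n" and "B \<in> carrier_mat n k"
  shows "mat_adjoint (A * B) = mat_adjoint B * mat_adjoint A"
  using assms by (intro eq_matI) (auto simp: scalar_prod_def mult.commute)

lemma scalar_prod_adjoint:
  fixes A :: "complex mat"
  assumes A: "A \<in> carrier_mat m n" and x: "x \<in> carrier_vec n" and y: "y \<in> carrier_vec m"
  shows "(A *\<^sub>v x) \<bullet>c y = x \<bullet>c (mat_adjoint A *\<^sub>v y)"
proof -
  have "(A *\<^sub>v x) \<bullet>c y = (\<Sum>i<m. \<Sum>j<n. A $$ (i, j) * x $ j * cnj (y $ i))"
    using assms by (auto simp: scalar_prod_def sum_distrib_right atLeast0LessThan)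
  also have "\<dots> = (\<Sum>j<n. \<Sum>i<m. A $$ (i, j) * x $ j * cnj (y $ i))"
    by (rule sum.swap)
  also have "\<dots> = x \<bullet>c (mat_adjoint A *\<^sub>v y)"
    using assms
    by (auto simp: scalar_prod_def sum_distrib_left atLeast0LessThan mult_ac intro!: sum.cong)
  finally show ?thesis .
qed

lemma adjoint_mat_diag_real [simp]:
  "mat_adjoint (mat_diag d (\<lambda>i. complex_of_real (h i))) = mat_diag d (\<lambda>i. complex_of_real (h i))"
  by (rule eq_matI) (auto simp: mat_diag_def)

definition normsq :: "complex vec \<Rightarrow> real" where
  "normsq x = Re (x \<bullet>c x)"

lemma vnorm_eq_sqrt: "vnorm x = sqrt (normsq x)"
  by (simp add: vnorm_def normsq_def)

lemma scalar_prod_self: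
  "x \<in> carrier_vec n \<Longrightarrow> x \<bullet>c x = complex_of_real (\<Sum>i<n. (cmod (x $ i))\<^sup>2)"
  by (auto simp: scalar_prod_def atLeast0LessThan simp flip: complex_norm_square intro!: sum.cong)

lemma normsq_eq_sum: "x \<in> carrier_vec n \<Longrightarrow> normsq x = (\<Sum>i<n. (cmod (x $ i))\<^sup>2)"
  unfolding normsq_def by (simp only: scalar_prod_self Re_complex_of_real)

lemma scalar_prod_self_normsq: "x \<in> carrier_vec n \<Longrightarrow> x \<bullet>c x = complex_of_real (normsq x)"
  by (simp only: scalar_prod_self normsq_eq_sum)

lemma normsq_nonneg [simp]: "0 \<le> normsq x"
  using normsq_eq_sum[of x "dim_vec x"] by (simp add: sum_nonneg)

lemma normsq_eq_0: "x \<in> carrier_vec n \<Longrightarrow> normsq x = 0 \<longleftrightarrow> x = 0\<^sub>v n"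
  using scalar_prod_self_normsq[of x n] conjugate_square_eq_0_vec[of x n] by auto

lemma normsq_pos: "x \<in> carrier_vec n \<Longrightarrow> x \<noteq> 0\<^sub>v n \<Longrightarrow> 0 < normsq x"
  using normsq_eq_0[of x n] normsq_nonneg[of x] by linarith

lemma normsq_smult: "normsq (complex_of_real r \<cdot>\<^sub>v x) = r\<^sup>2 * normsq x"
proof -
  have x: "x \<in> carrier_vec (dim_vec x)" by simp
  have "normsq (complex_of_real r \<cdot>\<^sub>v x) = (\<Sum>i<dim_vec x. (cmod (r * x $ i))\<^sup>2)"
    by (subst normsq_eq_sum[of _ "dim_vec x"]) auto
  then show ?thesis
    by (simp add: normsq_eq_sum[OF x] norm_mult power_mult_distrib sum_distrib_left)
qed

text \<open>
  The dimension count behind both the extension of orthonormal lists and the min-max principle.  A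
  square matrix with the conjugated \<open>ys\<close> as rows, padded by zero rows, is singular, and its kernel
  consists of vectors orthogonal to \<open>ys\<close>.
\<close>

lemma ex_nonzero_orthogonal:
  fixes ys :: "complex vec list"
  assumes "length ys < d" and ys: "set ys \<subseteq> carrier_vec d"
  shows "\<exists>x \<in> carrier_vec d. x \<noteq> 0\<^sub>v d \<and> (\<forall>y \<in> set ys. x \<bullet>c y = 0)"
proof -
  define zs where "zs = ys @ replicate (d - length ys) (0\<^sub>v d)"
  define A where "A = mat d d (\<lambda>(i, j). cnj (zs ! i $ j))"
  have A: "A \<in> carrier_mat d d" by (simp add: A_def)
  have len: "length zs = d" "zs ! (d - 1) = 0\<^sub>v d"
    using assms(1) by (auto simp: zs_def nth_append)
  have zs: "zs ! i \<in> carrier_vec d" if "i < d" for i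
    using that ys len(1) nth_mem[of i zs] by (auto simp: zs_def)
  \<comment> \<open>The last row of \<open>A\<close> is zero, so \<open>A\<close> has no inverse.\<close>
  have "\<exists>x. x \<in> carrier_vec d \<and> x \<noteq> 0\<^sub>v d \<and> A *\<^sub>v x = 0\<^sub>v d"
  proof -
    have "det A = 0"
    proof (rule ccontr)
      assume "det A \<noteq> 0"
      then obtain B where B: "B \<in> carrier_mat d d" "A * B = 1\<^sub>m d"
        using det_non_zero_imp_unit[OF A] unfolding Units_def ring_mat_simps by blast
      have "(A * B) $$ (d - 1, d - 1) = 0"
        using assms(1) B(1) A len by (simp add: scalar_prod_def) (simp add: A_def)
      then show False
        using B(2) assms(1) by simp
    qed
    then show ?thesis
      using det_0_iff_vec_prod_zero_field[OF A] by blast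
  qed
  then obtain x where x: "x \<in> carrier_vec d" "x \<noteq> 0\<^sub>v d" "A *\<^sub>v x = 0\<^sub>v d"
    by blast
  have "x \<bullet>c y = 0" if "y \<in> set ys" for y
  proof -
    have "y \<in> set zs" using that by (simp add: zs_def)
    then obtain i where i: "i < d" "y = zs ! i"
      using len(1) by (metis in_set_conv_nth)
    have "(A *\<^sub>v x) $ i = x \<bullet>c y"
      using i x(1) zs[of i] by (simp add: scalar_prod_def A_def mult.commute)
    then show ?thesis
      using x i by simp
  qed
  then show ?thesis
    using x by blast
qed

definition unitary :: "nat \<Rightarrow> complex mat \<Rightarrow> bool" where
  "unitary d U \<longleftrightarrow> U \<in> carrier_mat d d \<and> mat_adjoint U * U = 1\<^sub>m d"

lemma unitary_right: "unitary d U \<Longrightarrow> U * mat_adjoint U = 1\<^sub>m d"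
  unfolding unitary_def by (auto intro: mat_mult_left_right_inverse)

lemma unitary_adjoint: "unitary d U \<Longrightarrow> unitary d (mat_adjoint U)"
  using unitary_right[of d U] by (auto simp: unitary_def)

lemma normsq_unitary:
  assumes U: "unitary d U" and x: "x \<in> carrier_vec d"
  shows "normsq (U *\<^sub>v x) = normsq x"
proof -
  have U': "U \<in> carrier_mat d d" "mat_adjoint U * U = 1\<^sub>m d"
    using U by (auto simp: unitary_def)
  have "(U *\<^sub>v x) \<bullet>c (U *\<^sub>v x) = x \<bullet>c (mat_adjoint U *\<^sub>v (U *\<^sub>v x))"
    using U' x by (intro scalar_prod_adjoint) auto
  also have "mat_adjoint U *\<^sub>v (U *\<^sub>v x) = x"
    using U' x assoc_mult_mat_vec[of "mat_adjoint U" d d U d x] by simp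
  finally show ?thesis
    by (simp add: normsq_def)
qed

lemma adjoint_mult_index:
  fixes A B :: "complex mat"
  assumes "A \<in> carrier_mat m n" and "B \<in> carrier_mat m k" and "i < n" and "j < k"
  shows "(mat_adjoint A * B) $$ (i, j) = col B j \<bullet>c col A i"
proof -
  have "(mat_adjoint A * B) $$ (i, j) = (\<Sum>l = 0..<m. cnj (A $$ (l, i)) * B $$ (l, j))"
    using assms by (simp add: scalar_prod_def)
  also have "\<dots> = col B j \<bullet>c col A i"
    using assms by (simp add: scalar_prod_def mult.commute)
  finally show ?thesis .
qed

lemma gram_index:
  fixes vs :: "complex vec list"
  assumes "set vs \<subseteq> carrier_vec d" and "i < length vs" and "j < length vs"
  shows "(mat_adjoint (mat_of_cols d vs) * mat_of_cols d vs) $$ (i, j) = vs ! j \<bullet>c vs ! i"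
proof -
  have "vs ! i \<in> carrier_vec d" "vs ! j \<in> carrier_vec d"
    using assms nth_mem by blast+
  then show ?thesis
    using assms adjoint_mult_index[of "mat_of_cols d vs" d "length vs" "mat_of_cols d vs" "length vs" i j]
    by simp
qed

lemma unitary_orthonormal_basis:
  assumes "orthonormal_basis d vs"
  shows "unitary d (mat_of_cols d vs)"
proof -
  have "mat_adjoint (mat_of_cols d vs) * mat_of_cols d vs = 1\<^sub>m d"
    using assms gram_index[of vs d]
    by (intro eq_matI) (auto simp: orthonormal_basis_def simp del: index_mult_mat(1))
  then show ?thesis
    using assms mat_of_cols_carrier(1)[of d vs] by (auto simp: unitary_def orthonormal_basis_def)
qed

definition orthonormal :: "nat \<Rightarrow> complex vec list \<Rightarrow> bool" where
  "orthonormal d vs \<longleftrightarrow> set vs \<subseteq> carrier_vec d \<and>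
     (\<forall>i<length vs. \<forall>j<length vs. vs ! i \<bullet>c vs ! j = (if i = j then 1 else 0))"

lemma orthonormal_basis_iff: "orthonormal_basis d vs \<longleftrightarrow> length vs = d \<and> orthonormal d vs"
  by (auto simp: orthonormal_basis_def orthonormal_def)

lemma scalar_prod_swap:
  fixes x y :: "complex vec"
  assumes "x \<in> carrier_vec d" and "y \<in> carrier_vec d"
  shows "x \<bullet>c y = cnj (y \<bullet>c x)"
  using assms by (auto simp: scalar_prod_def mult.commute intro!: sum.cong)

lemma orthonormal_snoc:
  assumes vs: "orthonormal d vs" and x: "x \<in> carrier_vec d" "normsq x = 1"
    and orth: "\<And>v. v \<in> set vs \<Longrightarrow> x \<bullet>c v = 0"
  shows "orthonormal d (vs @ [x])"
proof -
  have xx: "x \<bullet>c x = 1"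
    using scalar_prod_self_normsq[OF x(1)] x(2) by simp
  have "v \<bullet>c x = 0" if "v \<in> set vs" for v
    using scalar_prod_swap[of v d x] orth[OF that] that vs x(1) by (auto simp: orthonormal_def)
  then show ?thesis
    using vs x xx orth by (auto simp: orthonormal_def nth_append less_Suc_eq)
qed

lemma ex_normalized:
  assumes "x \<in> carrier_vec d" and "x \<noteq> 0\<^sub>v d"
  shows "\<exists>r. normsq (complex_of_real r \<cdot>\<^sub>v x) = 1"
  using normsq_pos[OF assms] normsq_smult[of "1 / sqrt (normsq x)" x]
  by (intro exI[of _ "1 / sqrt (normsq x)"]) (simp add: power_divide)

lemma orthonormal_extend:
  "orthonormal d vs \<Longrightarrow> length vs \<le> d \<Longrightarrow> \<exists>ws. orthonormal_basis d (vs @ ws)"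
proof (induction "d - length vs" arbitrary: vs)
  case 0
  then show ?case
    by (intro exI[of _ "[]"]) (auto simp: orthonormal_basis_iff)
next
  case (Suc n)
  have vs: "set vs \<subseteq> carrier_vec d" and len: "length vs < d"
    using Suc by (auto simp: orthonormal_def)
  obtain x where x: "x \<in> carrier_vec d" "x \<noteq> 0\<^sub>v d" "\<forall>y \<in> set vs. x \<bullet>c y = 0"
    using ex_nonzero_orthogonal[OF len vs] by blast
  obtain r where r: "normsq (complex_of_real r \<cdot>\<^sub>v x) = 1"
    using ex_normalized[OF x(1,2)] by blast
  have "orthonormal d (vs @ [complex_of_real r \<cdot>\<^sub>v x])"
    using x r vs by (intro orthonormal_snoc[OF Suc.prems(1)]) (auto simp: subset_iff)
  then have "\<exists>ws. orthonormal_basis d ((vs @ [complex_of_real r \<cdot>\<^sub>v x]) @ ws)"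
    using Suc.hyps(2) len by (intro Suc.hyps(1)) auto
  then show ?case
    by auto
qed

lemma adjoint_mult_vec_index:
  fixes A :: "complex mat"
  assumes "A \<in> carrier_mat m n" and "x \<in> carrier_vec m" and "i < n"
  shows "(mat_adjoint A *\<^sub>v x) $ i = x \<bullet>c col A i"
proof -
  have "(mat_adjoint A *\<^sub>v x) $ i = (\<Sum>l = 0..<m. cnj (A $$ (l, i)) * x $ l)"
    using assms by (simp add: scalar_prod_def)
  also have "\<dots> = x \<bullet>c col A i"
    using assms by (simp add: scalar_prod_def mult.commute)
  finally show ?thesis .
qed

section \<open>The spectral theorem for Hermitian matrices\<close>

lemma hermitian_eigenvalue_real:
  fixes A :: "complex mat"
  assumes A: "A \<in> carrier_mat d d" "mat_adjoint A = A"
    and x: "x \<in> carrier_vec d" "normsq x = 1" and ev: "A *\<^sub>v x = e \<cdot>\<^sub>v x"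
  shows "e = complex_of_real (Re e)"
proof -
  have xx: "x \<bullet>c x = 1"
    using scalar_prod_self_normsq[OF x(1)] x(2) by simp
  have "(A *\<^sub>v x) \<bullet>c x = x \<bullet>c (A *\<^sub>v x)"
    using scalar_prod_adjoint[OF A(1) x(1) x(1)] A(2) by simp
  moreover have "(A *\<^sub>v x) \<bullet>c x = e"
    using x xx ev by simp
  moreover have "x \<bullet>c (A *\<^sub>v x) = cnj e"
    using scalar_prod_swap[of x d "A *\<^sub>v x"] A x calculation(2) by simp
  ultimately show ?thesis
    by (simp add: complex_eq_iff)
qed

lemma complex_eigenvalue_exists:
  fixes A :: "complex mat"
  assumes A: "A \<in> carrier_mat n n" and "0 < n"
  shows "\<exists>y e. y \<in> carrier_vec n \<and> y \<noteq> 0\<^sub>v n \<and> A *\<^sub>v y = e \<cdot>\<^sub>v y"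
proof -
  have "degree (char_poly A) = n"
    using degree_monic_char_poly[OF A] by simp
  then obtain e where "poly (char_poly A) e = 0"
    using fundamental_theorem_of_algebra[of "char_poly A"] assms(2) by (auto simp: constant_degree)
  then have "eigenvalue A e"
    using eigenvalue_root_char_poly[OF A] by simp
  then show ?thesis
    using A by (auto simp: eigenvalue_def eigenvector_def)
qed

text \<open>
  Complete the given eigenvectors to an orthonormal basis.  In that basis \<open>A\<close> is block diagonal,
  since it is Hermitian and the given vectors are eigenvectors.  Any eigenvector of the remaining
  block, padded by zeros, yields an eigenvector of \<open>A\<close> orthogonal to those already found.
\<close>

lemma hermitian_next_eigenvector:
  fixes A :: "complex mat"
  assumes A: "A \<in> carrier_mat d d" "mat_adjoint A = A"
    and vs: "orthonormal d vs" "length vs < d"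
    and ev: "\<And>i. i < length vs \<Longrightarrow> A *\<^sub>v (vs ! i) = complex_of_real (h i) \<cdot>\<^sub>v (vs ! i)"
  shows "\<exists>x e. orthonormal d (vs @ [x]) \<and> A *\<^sub>v x = complex_of_real e \<cdot>\<^sub>v x"
proof -
  define k where "k = length vs"
  obtain ws where us: "orthonormal_basis d (vs @ ws)"
    using orthonormal_extend[OF vs(1)] vs(2) by auto
  define us where "us = vs @ ws"
  have us_len: "length us = d" and us_car: "\<And>i. i < d \<Longrightarrow> us ! i \<in> carrier_vec d"
    and us_orth: "\<And>i j. i < d \<Longrightarrow> j < d \<Longrightarrow> us ! i \<bullet>c us ! j = (if i = j then 1 else 0)"
    using us nth_mem unfolding orthonormal_basis_def us_def by blast+
  have us_vs: "us ! i = vs ! i" if "i < k" for i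
    using that by (simp add: us_def k_def nth_append)
  define U where "U = mat_of_cols d us"
  have U: "unitary d U"
    using unitary_orthonormal_basis[OF us] by (simp add: U_def us_def)
  have Uc: "U \<in> carrier_mat d d" and UU: "mat_adjoint U * U = 1\<^sub>m d" "U * mat_adjoint U = 1\<^sub>m d"
    using U unitary_right[OF U] by (auto simp: unitary_def)
  have colU: "col U i = us ! i" if "i < d" for i
    using that us_len us_car by (simp add: U_def)
  define M where "M = mat_adjoint U * (A * U)"
  have M: "M \<in> carrier_mat d d"
    using A Uc by (simp add: M_def)
  have M_index: "M $$ (i, j) = (A *\<^sub>v us ! j) \<bullet>c us ! i" if "i < d" "j < d" for i j
  proof -
    have "col (A * U) j = A *\<^sub>v us ! j"
      using that A Uc colU[of j] by (metis col_mult2)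
    then show ?thesis
      unfolding M_def using that A Uc colU[of i] adjoint_mult_index[of U d d "A * U" d i j] by simp
  qed
  have M_zero: "M $$ (i, j) = 0" if "i < k" "k \<le> j" "j < d" for i j
  proof -
    have i: "i < d" using that by simp
    have "M $$ (i, j) = us ! j \<bullet>c (A *\<^sub>v us ! i)"
      using M_index[OF i that(3)] scalar_prod_adjoint[OF A(1) us_car[OF that(3)] us_car[OF i]] A(2)
      by simp
    also have "A *\<^sub>v us ! i = complex_of_real (h i) \<cdot>\<^sub>v us ! i"
      using ev[of i] that us_vs[of i] by (simp add: k_def)
    also have "us ! j \<bullet>c (complex_of_real (h i) \<cdot>\<^sub>v us ! i) = complex_of_real (h i) * (us ! j \<bullet>c us ! i)"
      using us_car[OF i] us_car[OF that(3)] by (simp add: conjugate_smult_vec)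
    finally show ?thesis
      using us_orth[OF that(3) i] that by simp
  qed
  \<comment> \<open>The trailing block of \<open>M\<close>, which acts on the orthogonal complement of \<open>vs\<close>.\<close>
  define A1 where "A1 = mat (d - k) (d - k) (\<lambda>(i, j). M $$ (i + k, j + k))"
  have "A1 \<in> carrier_mat (d - k) (d - k)" "0 < d - k"
    using vs(2) by (simp_all add: A1_def k_def)
  then obtain y e where y: "y \<in> carrier_vec (d - k)" "y \<noteq> 0\<^sub>v (d - k)" "A1 *\<^sub>v y = e \<cdot>\<^sub>v y"
    using complex_eigenvalue_exists by blast
  define z where "z = vec d (\<lambda>i. if i < k then 0 else y $ (i - k))"
  have z: "z \<in> carrier_vec d" by (simp add: z_def)
  have k: "k < d" using vs(2) by (simp add: k_def)
  have Mz: "M *\<^sub>v z = e \<cdot>\<^sub>v z"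
  proof (rule eq_vecI)
    fix i assume "i < dim_vec (e \<cdot>\<^sub>v z)"
    then have i: "i < d" by (simp add: z_def)
    have "(M *\<^sub>v z) $ i = (\<Sum>j = 0..<d. M $$ (i, j) * z $ j)"
      using i M z by (simp add: scalar_prod_def)
    also have "\<dots> = (\<Sum>j = 0..<k. M $$ (i, j) * z $ j) + (\<Sum>j = k..<d. M $$ (i, j) * z $ j)"
      using k by (simp add: sum.atLeastLessThan_concat)
    also have "(\<Sum>j = 0..<k. M $$ (i, j) * z $ j) = 0"
      using k by (intro sum.neutral) (auto simp: z_def)
    also have "(\<Sum>j = k..<d. M $$ (i, j) * z $ j) = (\<Sum>j = 0..<d - k. M $$ (i, j + k) * y $ j)"
      using k sum.shift_bounds_nat_ivl[of "\<lambda>j. M $$ (i, j) * z $ j" 0 k "d - k"]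
      by (simp add: z_def)
    also have "\<dots> = e * z $ i"
    proof (cases "i < k")
      case True
      then show ?thesis
        using M_zero[of i] i k by (simp add: z_def)
    next
      case False
      then have "(\<Sum>j = 0..<d - k. M $$ (i, j + k) * y $ j) = (A1 *\<^sub>v y) $ (i - k)"
        using i y(1) by (simp add: scalar_prod_def A1_def)
      then show ?thesis
        using y(1,3) i k False by (simp add: z_def)
    qed
    finally show "(M *\<^sub>v z) $ i = (e \<cdot>\<^sub>v z) $ i"
      using i z by simp
  qed (use M z in simp)
  have "z \<noteq> 0\<^sub>v d"
  proof
    assume *: "z = 0\<^sub>v d"
    have "y $ i = 0" if "i < d - k" for i
      using that arg_cong[OF *, of "\<lambda>z. z $ (i + k)"] by (simp add: z_def)
    then show False
      using y(1,2) by (auto intro: eq_vecI)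
  qed
  then obtain r where r: "normsq (complex_of_real r \<cdot>\<^sub>v z) = 1"
    using ex_normalized[OF z] by blast
  define w where "w = complex_of_real r \<cdot>\<^sub>v z"
  have w: "w \<in> carrier_vec d" "M *\<^sub>v w = e \<cdot>\<^sub>v w" "normsq w = 1" "\<And>i. i < k \<Longrightarrow> w $ i = 0"
    using z r Mz M k by (auto simp: w_def z_def mult_mat_vec smult_smult_assoc mult.commute)
  define x where "x = U *\<^sub>v w"
  have x: "x \<in> carrier_vec d" "normsq x = 1"
    using Uc w normsq_unitary[OF U w(1)] by (auto simp: x_def)
  have "A *\<^sub>v x = (U * M) *\<^sub>v w"
  proof -
    have "U * M = (U * mat_adjoint U) * (A * U)"
      unfolding M_def using Uc A by (intro assoc_mult_mat[symmetric]) auto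
    also have "\<dots> = A * U"
      using Uc A UU by simp
    finally show ?thesis
      using A Uc w by (simp add: x_def)
  qed
  also have "\<dots> = e \<cdot>\<^sub>v x"
    using Uc M w by (simp add: x_def mult_mat_vec)
  finally have Ax: "A *\<^sub>v x = e \<cdot>\<^sub>v x" .
  have "mat_adjoint U *\<^sub>v x = w"
    using Uc w(1) UU assoc_mult_mat_vec[of "mat_adjoint U" d d U d w] by (simp add: x_def)
  then have "x \<bullet>c vs ! i = 0" if "i < k" for i
    using adjoint_mult_vec_index[OF Uc x(1), of i] that k w(4) colU[of i] us_vs[of i] by simp
  then have "orthonormal d (vs @ [x])"
    using orthonormal_snoc[OF vs(1) x] by (metis in_set_conv_nth k_def)
  then show ?thesis
    using Ax hermitian_eigenvalue_real[OF A x Ax] by metis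
qed

lemma hermitian_orthonormal_eigenvectors:
  fixes A :: "complex mat"
  assumes A: "A \<in> carrier_mat d d" "mat_adjoint A = A"
  shows "k \<le> d \<Longrightarrow> \<exists>vs h. length vs = k \<and> orthonormal d vs \<and>
    (\<forall>i<k. A *\<^sub>v (vs ! i) = complex_of_real (h i) \<cdot>\<^sub>v (vs ! i))"
proof (induction k)
  case 0
  then show ?case by (intro exI[of _ "[]"]) (simp add: orthonormal_def)
next
  case (Suc k)
  then obtain vs h where vs: "length vs = k" "orthonormal d vs"
      "\<And>i. i < k \<Longrightarrow> A *\<^sub>v (vs ! i) = complex_of_real (h i) \<cdot>\<^sub>v (vs ! i)"
    by auto
  obtain x e where x: "orthonormal d (vs @ [x])" "A *\<^sub>v x = complex_of_real e \<cdot>\<^sub>v x"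
    using hermitian_next_eigenvector[OF A vs(2), of h] vs Suc.prems by auto
  show ?case
    using vs x by (intro exI[of _ "vs @ [x]"] exI[of _ "h(k := e)"]) (auto simp: nth_append less_Suc_eq)
qed

abbreviation real_diag :: "nat \<Rightarrow> (nat \<Rightarrow> real) \<Rightarrow> complex mat" where
  "real_diag d h \<equiv> mat_diag d (\<lambda>i. complex_of_real (h i))"

lemma eigenbasis_diagonalizes:
  fixes A :: "complex mat"
  assumes A: "A \<in> carrier_mat d d" and vs: "orthonormal_basis d vs"
    and ev: "\<And>i. i < d \<Longrightarrow> A *\<^sub>v (vs ! i) = complex_of_real (h i) \<cdot>\<^sub>v (vs ! i)"
  shows "A = mat_of_cols d vs * real_diag d h * mat_adjoint (mat_of_cols d vs)"
proof -
  let ?U = "mat_of_cols d vs"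
  have U: "unitary d ?U"
    using unitary_orthonormal_basis[OF vs] .
  have Uc: "?U \<in> carrier_mat d d" and UU: "?U * mat_adjoint ?U = 1\<^sub>m d"
    using U unitary_right[OF U] by (auto simp: unitary_def)
  have len: "length vs = d" and car: "vs ! i \<in> carrier_vec d" if "i < d" for i
    using vs that nth_mem unfolding orthonormal_basis_def by blast+
  have "A * ?U = ?U * real_diag d h"
  proof (rule eq_matI)
    fix i j assume "i < dim_row (?U * real_diag d h)" "j < dim_col (?U * real_diag d h)"
    then have ij: "i < d" "j < d" using Uc by (simp_all add: mat_diag_def)
    have "(A * ?U) $$ (i, j) = (A *\<^sub>v vs ! j) $ i"
      using ij A Uc car[of j] len[of j] by simp
    also have "\<dots> = vs ! j $ i * h j"
      using ij ev[of j] car[of j] by simp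
    also have "\<dots> = (?U * real_diag d h) $$ (i, j)"
      using ij Uc len[of j] by (simp add: mat_diag_mult_right[of _ d] mat_of_cols_index)
    finally show "(A * ?U) $$ (i, j) = (?U * real_diag d h) $$ (i, j)" .
  qed (use A Uc in \<open>auto simp: mat_diag_def\<close>)
  then have "?U * real_diag d h * mat_adjoint ?U = A * (?U * mat_adjoint ?U)"
    using A Uc by (metis adjoint_carrier assoc_mult_mat)
  then show ?thesis
    using UU A by simp
qed

lemma eigvals_desc_diagonalized:
  assumes U: "unitary d U" and A: "A = U * real_diag d h * mat_adjoint U"
  shows "eigvals_desc A = decr (map h [0..<d])"
proof -
  have Uc: "U \<in> carrier_mat d d" and UU: "mat_adjoint U * U = 1\<^sub>m d" "U * mat_adjoint U = 1\<^sub>m d"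
    using U unitary_right[OF U] by (auto simp: unitary_def)
  have "similar_mat A (real_diag d h)"
    unfolding similar_mat_def similar_mat_wit_def Let_def
    using A Uc UU by (intro exI[of _ U] exI[of _ "mat_adjoint U"]) auto
  then have "char_poly A = char_poly (real_diag d h)"
    by (rule char_poly_similar)
  also have "\<dots> = (\<Prod>a\<leftarrow>diag_mat (real_diag d h). [:- a, 1:])"
    by (rule char_poly_upper_triangular[of _ d]) (auto simp: upper_triangular_def mat_diag_def)
  also have "diag_mat (real_diag d h) = map (\<lambda>i. complex_of_real (h i)) [0..<d]"
    by (auto simp: diag_mat_def mat_diag_def)
  finally have "char_poly A = (\<Prod>i\<leftarrow>[0..<d]. [:- complex_of_real (h i), 1:])"
    by (simp add: comp_def)
  moreover have "proots (\<Prod>i\<leftarrow>is. [:- complex_of_real (h i), 1:]) =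
      mset (map (\<lambda>i. complex_of_real (h i)) is)" for "is" :: "nat list"
  proof (induction "is")
    case (Cons a "is")
    have "(\<Prod>i\<leftarrow>is. [:- complex_of_real (h i), 1:]) \<noteq> 0"
      by (auto simp: prod_list_zero_iff)
    then show ?case
      using Cons by (simp add: proots_mult del: mult_pCons_left)
  qed simp
  ultimately have "image_mset Re (proots (char_poly A)) = mset (map h [0..<d])"
    by (simp add: image_mset.compositionality comp_def)
  then show ?thesis
    unfolding eigvals_desc_def decr_def by (simp only: sorted_list_of_multiset_mset)
qed

lemma orthonormal_basis_permute:
  assumes vs: "orthonormal_basis d vs" and p: "p permutes {..<d}"
  shows "orthonormal_basis d (permute_list p vs)"
proof -
  have len: "length vs = d"
    using vs by (simp add: orthonormal_basis_def)
  have nth: "permute_list p vs ! i = vs ! p i" "p i < d" if "i < d" for i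
    using p len that permutes_in_image[OF p, of i] by (simp_all add: permute_list_nth)
  have "p i = p j \<longleftrightarrow> i = j" for i j
    using permutes_inj[OF p] by (simp add: inj_eq)
  then show ?thesis
    using vs p len nth by (simp add: orthonormal_basis_def)
qed

text \<open>
  An orthonormal eigenbasis comes with its eigenvalues in no particular order; permuting it aligns
  it with the sorted list of roots of the characteristic polynomial.
\<close>

theorem hermitian_spectral_decomposition:
  fixes A :: "complex mat"
  assumes A: "A \<in> carrier_mat d d" "mat_adjoint A = A"
  shows "length (eigvals_desc A) = d \<and> decr (eigvals_desc A) = eigvals_desc A \<and>
    (\<exists>vs. orthonormal_basis d vs \<and>
      A = mat_of_cols d vs * real_diag d (\<lambda>i. eigvals_desc A ! i) * mat_adjoint (mat_of_cols d vs))"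
proof -
  obtain vs h where vs: "orthonormal_basis d vs"
    and ev: "\<And>i. i < d \<Longrightarrow> A *\<^sub>v (vs ! i) = complex_of_real (h i) \<cdot>\<^sub>v (vs ! i)"
    using hermitian_orthonormal_eigenvectors[OF A, of d] by (auto simp: orthonormal_basis_iff)
  have eig: "eigvals_desc A = decr (map h [0..<d])"
    using eigvals_desc_diagonalized[OF unitary_orthonormal_basis[OF vs] eigenbasis_diagonalizes[OF A(1) vs ev]] .
  obtain p where p: "p permutes {..<d}" "permute_list p (map h [0..<d]) = decr (map h [0..<d])"
    using mset_eq_permutation[of "decr (map h [0..<d])" "map h [0..<d]"] by auto
  have pd: "p i < d" if "i < d" for i
    using that permutes_in_image[OF p(1), of i] by simp
  have eig_nth: "eigvals_desc A ! i = h (p i)" if "i < d" for i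
    using that p pd[OF that] eig permute_list_nth[of p "map h [0..<d]" i] by simp
  have "length vs = d"
    using vs by (simp add: orthonormal_basis_def)
  then have "A *\<^sub>v (permute_list p vs ! i) =
      complex_of_real (eigvals_desc A ! i) \<cdot>\<^sub>v (permute_list p vs ! i)" if "i < d" for i
    using that p(1) ev[OF pd[OF that]] eig_nth[OF that] by (simp add: permute_list_nth)
  then have "A = mat_of_cols d (permute_list p vs) * real_diag d (\<lambda>i. eigvals_desc A ! i) *
      mat_adjoint (mat_of_cols d (permute_list p vs))"
    by (rule eigenbasis_diagonalizes[OF A(1) orthonormal_basis_permute[OF vs p(1)]])
  then show ?thesis
    using orthonormal_basis_permute[OF vs p(1)] eig decr_cong_mset[of "eigvals_desc A" "map h [0..<d]"]
    by auto
qed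

lemma mat_sum_outer:
  assumes vs: "length vs = d" "set vs \<subseteq> carrier_vec d"
  shows "mat_sum d d (\<lambda>i. of_real (h i) \<cdot>\<^sub>m outer (vs ! i) (vs ! i)) =
    mat_of_cols d vs * real_diag d h * mat_adjoint (mat_of_cols d vs)" (is "_ = ?U * _ * _")
proof (rule eq_matI)
  have U: "?U \<in> carrier_mat d d" using vs(1) by (auto intro: carrier_matI)
  fix i j
  assume "i < dim_row (?U * real_diag d h * mat_adjoint ?U)"
    and "j < dim_col (?U * real_diag d h * mat_adjoint ?U)"
  then have ij: "i < d" "j < d" by simp_all
  have dim: "dim_vec (vs ! k) = d" if "k < d" for k
    using vs that nth_mem[of k vs] carrier_vecD by blast
  have "(?U * real_diag d h * mat_adjoint ?U) $$ (i, j) =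
      (\<Sum>k = 0..<d. vs ! k $ i * h k * cnj (vs ! k $ j))"
    using ij U vs(1) by (simp add: scalar_prod_def mat_diag_mult_right[OF U] mat_of_cols_index)
  also have "\<dots> = (\<Sum>k<d. h k * (vs ! k $ i * cnj (vs ! k $ j)))"
    by (simp add: atLeast0LessThan mult_ac)
  also have "\<dots> = mat_sum d d (\<lambda>i. of_real (h i) \<cdot>\<^sub>m outer (vs ! i) (vs ! i)) $$ (i, j)"
    using ij dim by (auto simp: mat_sum_def outer_def intro!: sum.cong)
  finally show "mat_sum d d (\<lambda>i. of_real (h i) \<cdot>\<^sub>m outer (vs ! i) (vs ! i)) $$ (i, j) =
    (?U * real_diag d h * mat_adjoint ?U) $$ (i, j)" by simp
qed (use vs in \<open>auto simp: mat_sum_def\<close>)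

section \<open>Eigenvalues under congruence\<close>

lemma real_diag_mult_vec:
  assumes y: "y \<in> carrier_vec d"
  shows "real_diag d h *\<^sub>v y = vec d (\<lambda>i. complex_of_real (h i) * y $ i)"
proof (rule eq_vecI)
  fix i assume "i < dim_vec (vec d (\<lambda>i. complex_of_real (h i) * y $ i))"
  then have i: "i < d" by simp
  have "(real_diag d h *\<^sub>v y) $ i = (\<Sum>j = 0..<d. (if i = j then complex_of_real (h j) else 0) * y $ j)"
    using i y by (simp add: mat_diag_def scalar_prod_def)
  also have "\<dots> = (\<Sum>j = 0..<d. if j = i then complex_of_real (h j) * y $ j else 0)"
    by (intro sum.cong) auto
  also have "\<dots> = vec d (\<lambda>i. complex_of_real (h i) * y $ i) $ i"
    using i by simp
  finally show "(real_diag d h *\<^sub>v y) $ i = vec d (\<lambda>i. complex_of_real (h i) * y $ i) $ i" .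
qed (simp add: mat_diag_def)

lemma form_diagonalized:
  assumes U: "unitary d U" and x: "x \<in> carrier_vec d"
  shows "Re (((U * real_diag d h * mat_adjoint U) *\<^sub>v x) \<bullet>c x) =
    (\<Sum>i<d. h i * (cmod ((mat_adjoint U *\<^sub>v x) $ i))\<^sup>2)"
proof -
  have Uc: "U \<in> carrier_mat d d" using U by (simp add: unitary_def)
  define y where "y = mat_adjoint U *\<^sub>v x"
  have y: "y \<in> carrier_vec d" using Uc x by (simp add: y_def)
  have "(U * real_diag d h * mat_adjoint U) *\<^sub>v x = U *\<^sub>v (real_diag d h *\<^sub>v y)"
    using Uc x by (simp add: y_def assoc_mult_mat_vec[of _ d d _ d])
  then have "((U * real_diag d h * mat_adjoint U) *\<^sub>v x) \<bullet>c x = (real_diag d h *\<^sub>v y) \<bullet>c y"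
    using scalar_prod_adjoint[OF Uc, of "real_diag d h *\<^sub>v y" x] x y
    by (simp add: y_def mult_mat_vec_carrier[of _ d d])
  also have "real_diag d h *\<^sub>v y = vec d (\<lambda>i. h i * y $ i)"
    using y by (rule real_diag_mult_vec)
  also have "vec d (\<lambda>i. h i * y $ i) \<bullet>c y = complex_of_real (\<Sum>i<d. h i * (cmod (y $ i))\<^sup>2)"
    using y by (auto simp: scalar_prod_def atLeast0LessThan complex_norm_square mult.assoc
        simp del: of_real_power intro!: sum.cong)
  finally show ?thesis
    by (simp add: y_def)
qed

text \<open>
  A form of the min-max principle.  There are \<open>d - 1\<close> linear conditions that place \<open>x\<close> in the span
  of the eigenvectors of \<open>H = W diag(h) W\<^sup>*\<close> from index \<open>k\<close> on, and \<open>T x\<close> in the span of those of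
  \<open>K = U diag(g) U\<^sup>*\<close> up to index \<open>k\<close>.  A nonzero solution satisfies
  \<open>c g\<^sub>k |x|\<^sup>2 \<le> g\<^sub>k |T x|\<^sup>2 \<le> \<langle>K T x, T x\<rangle> \<le> \<langle>H x, x\<rangle> \<le> h\<^sub>k |x|\<^sup>2\<close>.
\<close>

lemma eigenvalue_comparison:
  assumes U: "unitary d U" and W: "unitary d W" and T: "T \<in> carrier_mat d d"
    and g: "\<And>i j. i \<le> j \<Longrightarrow> j < d \<Longrightarrow> g j \<le> g i"
    and h: "\<And>i j. i \<le> j \<Longrightarrow> j < d \<Longrightarrow> h j \<le> h i"
    and form: "\<And>x. x \<in> carrier_vec d \<Longrightarrow>
      Re (((U * real_diag d g * mat_adjoint U) *\<^sub>v (T *\<^sub>v x)) \<bullet>c (T *\<^sub>v x))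
        \<le> Re (((W * real_diag d h * mat_adjoint W) *\<^sub>v x) \<bullet>c x)"
    and expand: "\<And>x. x \<in> carrier_vec d \<Longrightarrow> c * normsq x \<le> normsq (T *\<^sub>v x)"
    and k: "k < d" "0 \<le> g k"
  shows "c * g k \<le> h k"
proof -
  have Uc: "U \<in> carrier_mat d d" and Wc: "W \<in> carrier_mat d d"
    using U W by (auto simp: unitary_def)
  \<comment> \<open>Orthogonality to the first part kills the coordinates of \<open>x\<close> before \<open>k\<close> with respect to \<open>W\<close>, orthogonality to the second part those of \<open>T x\<close> after \<open>k\<close> with respect to \<open>U\<close>.\<close>
  define ys where "ys = map (col W) [0..<k] @ map (\<lambda>i. mat_adjoint T *\<^sub>v col U i) [Suc k..<d]"
  have "length ys < d" "set ys \<subseteq> carrier_vec d"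
    using k Uc Wc T by (auto simp: ys_def )
  then obtain x where x: "x \<in> carrier_vec d" "x \<noteq> 0\<^sub>v d" and orth: "\<And>y. y \<in> set ys \<Longrightarrow> x \<bullet>c y = 0"
    using ex_nonzero_orthogonal by blast
  have Tx: "T *\<^sub>v x \<in> carrier_vec d" using T x by simp
  have W0: "(mat_adjoint W *\<^sub>v x) $ i = 0" if "i < k" for i
    using adjoint_mult_vec_index[OF Wc x(1), of i] that k orth[of "col W i"] by (simp add: ys_def)
  have U0: "(mat_adjoint U *\<^sub>v (T *\<^sub>v x)) $ i = 0" if "k < i" "i < d" for i
  proof -
    have "(mat_adjoint U *\<^sub>v (T *\<^sub>v x)) $ i = (T *\<^sub>v x) \<bullet>c col U i"
      using adjoint_mult_vec_index[OF Uc Tx] that by simp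
    also have "\<dots> = x \<bullet>c (mat_adjoint T *\<^sub>v col U i)"
      using scalar_prod_adjoint[OF T x(1), of "col U i"] Uc col_dim[of U i] by simp
    also have "\<dots> = 0"
      using that by (intro orth) (auto simp: ys_def)
    finally show ?thesis .
  qed
  have "c * g k * normsq x \<le> g k * normsq (T *\<^sub>v x)"
    using mult_left_mono[OF expand[OF x(1)] k(2)] by (simp add: mult_ac)
  also have "\<dots> = g k * normsq (mat_adjoint U *\<^sub>v (T *\<^sub>v x))"
    using normsq_unitary[OF unitary_adjoint[OF U] Tx] by simp
  also have "\<dots> = (\<Sum>i<d. g k * (cmod ((mat_adjoint U *\<^sub>v (T *\<^sub>v x)) $ i))\<^sup>2)"
    using Uc Tx by (subst normsq_eq_sum[of _ d]) (auto simp: sum_distrib_left )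
  also have "\<dots> \<le> (\<Sum>i<d. g i * (cmod ((mat_adjoint U *\<^sub>v (T *\<^sub>v x)) $ i))\<^sup>2)"
  proof (rule sum_mono)
    fix i assume "i \<in> {..<d}"
    then show "g k * (cmod ((mat_adjoint U *\<^sub>v (T *\<^sub>v x)) $ i))\<^sup>2
        \<le> g i * (cmod ((mat_adjoint U *\<^sub>v (T *\<^sub>v x)) $ i))\<^sup>2"
      using U0[of i] g[of i k] k by (cases "k < i") (auto intro: mult_right_mono)
  qed
  also have "\<dots> \<le> (\<Sum>i<d. h i * (cmod ((mat_adjoint W *\<^sub>v x) $ i))\<^sup>2)"
    using form[OF x(1)] form_diagonalized[OF U Tx] form_diagonalized[OF W x(1)] by simp
  also have "\<dots> \<le> (\<Sum>i<d. h k * (cmod ((mat_adjoint W *\<^sub>v x) $ i))\<^sup>2)"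
  proof (rule sum_mono)
    fix i assume "i \<in> {..<d}"
    then show "h i * (cmod ((mat_adjoint W *\<^sub>v x) $ i))\<^sup>2
        \<le> h k * (cmod ((mat_adjoint W *\<^sub>v x) $ i))\<^sup>2"
      using W0[of i] h[of k i] by (cases "i < k") (auto intro: mult_right_mono)
  qed
  also have "\<dots> = h k * normsq (mat_adjoint W *\<^sub>v x)"
    using Wc x by (subst normsq_eq_sum[of _ d]) (auto simp: sum_distrib_left )
  also have "\<dots> = h k * normsq x"
    using normsq_unitary[OF unitary_adjoint[OF W] x(1)] by simp
  finally show ?thesis
    using normsq_pos[OF x] by (simp add: mult_le_cancel_right)
qed

lemma normsq_minus_smult:
  assumes x: "x \<in> carrier_vec d" and y: "y \<in> carrier_vec d"
  shows "normsq (x - complex_of_real r \<cdot>\<^sub>v y) = normsq x - 2 * r * Re (x \<bullet>c y) + r\<^sup>2 * normsq y"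
proof -
  have "normsq (x - complex_of_real r \<cdot>\<^sub>v y) = (\<Sum>i<d. (cmod (x $ i - r * y $ i))\<^sup>2)"
    using assms by (subst normsq_eq_sum[of _ d]) auto
  also have "\<dots> = (\<Sum>i<d. (cmod (x $ i))\<^sup>2 - 2 * r * Re (x $ i * cnj (y $ i)) + r\<^sup>2 * (cmod (y $ i))\<^sup>2)"
    by (intro sum.cong refl, unfold cmod_power2) (simp add: power2_eq_square algebra_simps)
  also have "\<dots> = normsq x - 2 * r * (\<Sum>i<d. Re (x $ i * cnj (y $ i))) + r\<^sup>2 * normsq y"
    by (simp only: sum.distrib sum_subtractf sum_distrib_left[symmetric] normsq_eq_sum[OF x] normsq_eq_sum[OF y])
  also have "(\<Sum>i<d. Re (x $ i * cnj (y $ i))) = Re (x \<bullet>c y)"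
    using assms by (simp add: scalar_prod_def atLeast0LessThan)
  finally show ?thesis .
qed

text \<open>
  \<open>V V\<^sup>*\<close> and \<open>V\<^sup>* V\<close> have the same spectral bounds.  Here the bounds pass from \<open>V\<close> to \<open>V\<^sup>*\<close> by
  expanding \<open>|V\<^sup>* x - \<alpha> V\<^sup>-\<^sup>1 x|\<^sup>2 \<ge> 0\<close> and \<open>|V V\<^sup>* x - \<beta> x|\<^sup>2 \<ge> 0\<close>.
\<close>

lemma adjoint_norm_bounds:
  assumes V: "V \<in> carrier_mat d d" and B: "B \<in> carrier_mat d d" "V * B = 1\<^sub>m d"
    and lower: "\<And>y. y \<in> carrier_vec d \<Longrightarrow> \<alpha> * normsq y \<le> normsq (V *\<^sub>v y)"
    and upper: "\<And>y. y \<in> carrier_vec d \<Longrightarrow> normsq (V *\<^sub>v y) \<le> \<beta> * normsq y"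
    and pos: "0 \<le> \<alpha>" "0 < \<beta>" and x: "x \<in> carrier_vec d"
  shows "\<alpha> * normsq x \<le> normsq (mat_adjoint V *\<^sub>v x)"
    and "normsq (mat_adjoint V *\<^sub>v x) \<le> \<beta> * normsq x"
proof -
  define z where "z = mat_adjoint V *\<^sub>v x"
  define y where "y = B *\<^sub>v x"
  have z: "z \<in> carrier_vec d" and y: "y \<in> carrier_vec d" using V B x by (simp_all add: z_def y_def)
  have Vy: "V *\<^sub>v y = x"
    using V B x assoc_mult_mat_vec[OF V B(1) x] by (simp add: y_def)
  have "y \<bullet>c z = x \<bullet>c x"
    using scalar_prod_adjoint[OF V y x] Vy by (simp add: z_def)
  then have "z \<bullet>c y = x \<bullet>c x"
    using scalar_prod_swap[OF z y] scalar_prod_self_normsq[OF x] by simp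
  then have "0 \<le> normsq z - 2 * \<alpha> * normsq x + \<alpha>\<^sup>2 * normsq y"
    using normsq_minus_smult[OF z y, of \<alpha>] normsq_nonneg[of "z - complex_of_real \<alpha> \<cdot>\<^sub>v y"]
    by (simp add: normsq_def)
  also have "\<alpha>\<^sup>2 * normsq y \<le> \<alpha> * normsq x"
    using mult_left_mono[OF lower[OF y] pos(1)] Vy by (simp add: power2_eq_square)
  finally show "\<alpha> * normsq x \<le> normsq z"
    by simp
  have Vz: "V *\<^sub>v z \<in> carrier_vec d" using V z by simp
  have "(V *\<^sub>v z) \<bullet>c x = z \<bullet>c z"
    using scalar_prod_adjoint[OF V z x] by (simp add: z_def)
  then have "0 \<le> normsq (V *\<^sub>v z) - 2 * \<beta> * normsq z + \<beta>\<^sup>2 * normsq x"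
    using normsq_minus_smult[OF Vz x, of \<beta>] normsq_nonneg[of "V *\<^sub>v z - complex_of_real \<beta> \<cdot>\<^sub>v x"]
    by (simp add: normsq_def)
  also have "\<dots> \<le> \<beta> * normsq z - 2 * \<beta> * normsq z + \<beta>\<^sup>2 * normsq x"
    using upper[OF z] by simp
  finally have "\<beta> * normsq z \<le> \<beta> * (\<beta> * normsq x)"
    by (simp add: power2_eq_square mult.assoc)
  then show "normsq z \<le> \<beta> * normsq x"
    using pos(2) by simp
qed

text \<open>
  Ostrowski's theorem on congruences.  The lower bound compares \<open>S = U diag(a) U\<^sup>*\<close> with \<open>V S V\<^sup>*\<close>
  through \<open>T = V\<^sup>*\<close>; the upper bound is the same comparison with the roles exchanged, through
  \<open>T = (V\<^sup>*)\<^sup>-\<^sup>1\<close>.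
\<close>

lemma congruence_eigenvalue_bounds:
  assumes U: "unitary d U" and W: "unitary d W"
    and V: "V \<in> carrier_mat d d" and B: "B \<in> carrier_mat d d" "V * B = 1\<^sub>m d"
    and cong: "V * (U * real_diag d a * mat_adjoint U) * mat_adjoint V =
      W * real_diag d g * mat_adjoint W"
    and lower: "\<And>y. y \<in> carrier_vec d \<Longrightarrow> \<alpha> * normsq y \<le> normsq (V *\<^sub>v y)"
    and upper: "\<And>y. y \<in> carrier_vec d \<Longrightarrow> normsq (V *\<^sub>v y) \<le> \<beta> * normsq y"
    and pos: "0 < \<alpha>" "0 < \<beta>"
    and a: "\<And>i j. i \<le> j \<Longrightarrow> j < d \<Longrightarrow> a j \<le> a i"
    and g: "\<And>i j. i \<le> j \<Longrightarrow> j < d \<Longrightarrow> g j \<le> g i"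
    and k: "k < d" "0 \<le> a k"
  shows "\<alpha> * a k \<le> g k" and "g k \<le> \<beta> * a k"
proof -
  define S where "S = U * real_diag d a * mat_adjoint U"
  define H where "H = W * real_diag d g * mat_adjoint W"
  have S: "S \<in> carrier_mat d d" and H: "H \<in> carrier_mat d d"
    using U W by (simp_all add: S_def H_def unitary_def)
  have HS: "H = V * S * mat_adjoint V"
    using cong by (simp add: S_def H_def)
  have form: "(H *\<^sub>v x) \<bullet>c x = (S *\<^sub>v (mat_adjoint V *\<^sub>v x)) \<bullet>c (mat_adjoint V *\<^sub>v x)"
    if x: "x \<in> carrier_vec d" for x
  proof -
    have "H *\<^sub>v x = V *\<^sub>v (S *\<^sub>v (mat_adjoint V *\<^sub>v x))"
      using V S x by (simp add: HS assoc_mult_mat_vec[of _ d d _ d])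
    then show ?thesis
      using scalar_prod_adjoint[OF V, of "S *\<^sub>v (mat_adjoint V *\<^sub>v x)" x] V S x by simp
  qed
  show lo: "\<alpha> * a k \<le> g k"
  proof (rule eigenvalue_comparison[OF U W adjoint_carrier[OF V]])
    show "Re (((U * real_diag d a * mat_adjoint U) *\<^sub>v (mat_adjoint V *\<^sub>v x)) \<bullet>c (mat_adjoint V *\<^sub>v x))
        \<le> Re (((W * real_diag d g * mat_adjoint W) *\<^sub>v x) \<bullet>c x)" if "x \<in> carrier_vec d" for x
      using form[OF that] by (simp add: S_def H_def)
    show "\<alpha> * normsq x \<le> normsq (mat_adjoint V *\<^sub>v x)" if "x \<in> carrier_vec d" for x
      using adjoint_norm_bounds(1)[OF V B lower upper _ pos(2) that] pos by simp
  qed (use a g k in auto)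
  have BV: "mat_adjoint V * mat_adjoint B = 1\<^sub>m d"
    using adjoint_mult[OF B(1) V] mat_mult_left_right_inverse[OF V B] by simp
  have VB: "mat_adjoint V *\<^sub>v (mat_adjoint B *\<^sub>v x) = x" if x: "x \<in> carrier_vec d" for x
    using V B x BV assoc_mult_mat_vec[of "mat_adjoint V" d d "mat_adjoint B" d x] by simp
  have "1 / \<beta> * g k \<le> a k"
  proof (rule eigenvalue_comparison[OF W U adjoint_carrier[OF B(1)]])
    show "Re (((W * real_diag d g * mat_adjoint W) *\<^sub>v (mat_adjoint B *\<^sub>v x)) \<bullet>c (mat_adjoint B *\<^sub>v x))
        \<le> Re (((U * real_diag d a * mat_adjoint U) *\<^sub>v x) \<bullet>c x)" if "x \<in> carrier_vec d" for x
      using form[of "mat_adjoint B *\<^sub>v x"] VB[OF that] that B by (simp add: S_def H_def)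
    show "1 / \<beta> * normsq x \<le> normsq (mat_adjoint B *\<^sub>v x)" if "x \<in> carrier_vec d" for x
      using adjoint_norm_bounds(2)[OF V B lower upper _ pos(2), of "mat_adjoint B *\<^sub>v x"]
        VB[OF that] that B pos by (simp add: field_simps)
    show "0 \<le> g k"
      using lo pos k by (smt (verit) mult_nonneg_nonneg)
  qed (use a g k in auto)
  then show "g k \<le> \<beta> * a k"
    using pos by (simp add: field_simps)
qed

section \<open>Rigidity of the extremal spectrum\<close>

definition mat_trace :: "complex mat \<Rightarrow> complex" where
  "mat_trace A = (\<Sum>i<dim_row A. A $$ (i, i))"

lemma mat_trace_mult:
  assumes "A \<in> carrier_mat d d" and "B \<in> carrier_mat d d"
  shows "mat_trace (A * B) = (\<Sum>i<d. \<Sum>j<d. A $$ (i, j) * B $$ (j, i))"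
  using assms by (simp add: mat_trace_def scalar_prod_def atLeast0LessThan)

lemma mat_trace_comm:
  assumes "A \<in> carrier_mat d d" and "B \<in> carrier_mat d d"
  shows "mat_trace (A * B) = mat_trace (B * A)"
  unfolding mat_trace_mult[OF assms] mat_trace_mult[OF assms(2,1)]
  by (subst sum.swap) (intro sum.cong refl mult.commute)

lemma mat_trace_real_diag: "mat_trace (real_diag d h) = complex_of_real (\<Sum>i<d. h i)"
  by (simp add: mat_trace_def mat_diag_def)

text \<open>
  With \<open>R = V U\<close> and \<open>D\<close> diagonal, \<open>R D R\<^sup>*\<close> is \<open>V S V\<^sup>*\<close>, and \<open>R\<^sup>* R\<close> is the matrix of \<open>V\<^sup>* V\<close> in the
  eigenbasis of \<open>S\<close>.
\<close>

lemma congruence_trace: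
  assumes R: "R \<in> carrier_mat d d" and D: "D \<in> carrier_mat d d"
  shows "mat_trace (R * D * mat_adjoint R) = mat_trace (D * (mat_adjoint R * R))"
    and "mat_trace ((R * D * mat_adjoint R) * (R * D * mat_adjoint R)) =
      mat_trace ((D * (mat_adjoint R * R)) * (D * (mat_adjoint R * R)))"
proof -
  note assoc = assoc_mult_mat[of _ d d _ d _ d]
  have "mat_trace (R * (D * mat_adjoint R)) = mat_trace ((D * mat_adjoint R) * R)"
    using R D by (intro mat_trace_comm) auto
  then show "mat_trace (R * D * mat_adjoint R) = mat_trace (D * (mat_adjoint R * R))"
    using R D by (simp add: assoc)
  have "mat_trace (R * (D * mat_adjoint R * (R * (D * mat_adjoint R)))) =
      mat_trace ((D * mat_adjoint R * (R * (D * mat_adjoint R))) * R)"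
    using R D by (intro mat_trace_comm) auto
  then show "mat_trace ((R * D * mat_adjoint R) * (R * D * mat_adjoint R)) =
      mat_trace ((D * (mat_adjoint R * R)) * (D * (mat_adjoint R * R)))"
    using R D by (simp add: assoc)
qed

text \<open>
  Only the first two power sums of the eigenvalues of \<open>V S V\<^sup>*\<close> enter.  They express \<open>\<Sum> m\<^sub>i\<^sup>2\<close> as the
  squared diagonal \<open>b\<close> plus nonnegative off-diagonal terms, while \<open>\<Sum> b\<^sub>i\<^sup>2 \<ge> \<Sum> m\<^sub>i\<^sup>2\<close> because \<open>m\<close> is a
  clamped constant with the same sum as \<open>b\<close>; so both defects vanish.
\<close>

lemma congruence_rigidity:
  assumes U: "unitary d U" and W: "unitary d W" and V: "V \<in> carrier_mat d d"
    and cong: "V * (U * real_diag d a * mat_adjoint U) * mat_adjoint V =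
      W * real_diag d m * mat_adjoint W"
    and lower: "\<And>y. y \<in> carrier_vec d \<Longrightarrow> \<alpha> * normsq y \<le> normsq (V *\<^sub>v y)"
    and upper: "\<And>y. y \<in> carrier_vec d \<Longrightarrow> normsq (V *\<^sub>v y) \<le> \<beta> * normsq y"
    and a: "\<And>i. i < d \<Longrightarrow> 0 < a i"
    and above: "\<And>i. i < d \<Longrightarrow> c < m i \<Longrightarrow> m i \<le> \<alpha> * a i"
    and below: "\<And>i. i < d \<Longrightarrow> m i < c \<Longrightarrow> \<beta> * a i \<le> m i"
  shows "mat_adjoint V * V = U * real_diag d (\<lambda>i. m i / a i) * mat_adjoint U"
proof -
  note assoc = assoc_mult_mat[of _ d d _ d _ d]
  have Uc: "U \<in> carrier_mat d d" and Wc: "W \<in> carrier_mat d d"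
    and WW: "mat_adjoint W * W = 1\<^sub>m d"
    using U W by (auto simp: unitary_def)
  define R where "R = V * U"
  define Q where "Q = mat_adjoint R * R"
  have R: "R \<in> carrier_mat d d" and Q: "Q \<in> carrier_mat d d"
    using V Uc by (simp_all add: R_def Q_def)
  have Q_index: "Q $$ (i, j) = col R j \<bullet>c col R i" if "i < d" "j < d" for i j
    unfolding Q_def using adjoint_mult_index[OF R R that] .
  have colR: "col R i \<in> carrier_vec d" for i
    using R col_dim[of R i] by simp
  have Q_swap: "Q $$ (j, i) = cnj (Q $$ (i, j))" if "i < d" "j < d" for i j
    unfolding Q_index[OF that] Q_index[OF that(2,1)] by (rule scalar_prod_swap[OF colR colR])
  define b where "b i = a i * normsq (col R i)" for i
  have Q_diag: "Q $$ (i, i) = complex_of_real (normsq (col R i))" if "i < d" for i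
    unfolding Q_index[OF that that] by (rule scalar_prod_self_normsq[OF colR])
  have colR_bounds: "\<alpha> \<le> normsq (col R i)" "normsq (col R i) \<le> \<beta>" if "i < d" for i
  proof -
    have "col R i = V *\<^sub>v col U i"
      unfolding R_def by (rule col_mult2[OF V Uc that])
    moreover have "col U i \<in> carrier_vec d"
      using Uc col_dim[of U i] by simp
    moreover have "normsq (col U i) = 1"
      using adjoint_mult_index[OF Uc Uc that that] U that by (simp add: unitary_def normsq_def)
    ultimately show "\<alpha> \<le> normsq (col R i)" "normsq (col R i) \<le> \<beta>"
      using lower[of "col U i"] upper[of "col U i"] by simp_all
  qed
  have H: "R * real_diag d a * mat_adjoint R = W * real_diag d m * mat_adjoint W"
    using cong V Uc adjoint_mult[OF V Uc] by (simp add: R_def assoc)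
  have DQ_index: "(real_diag d a * Q) $$ (i, j) = a i * Q $$ (i, j)" if "i < d" "j < d" for i j
    using that mat_diag_mult_left[OF Q] by simp
  have "complex_of_real (\<Sum>i<d. b i) = mat_trace (real_diag d a * Q)"
    by (simp add: mat_trace_def DQ_index Q_diag b_def del: index_mult_mat(1))
  also have "\<dots> = mat_trace (W * real_diag d m * mat_adjoint W)"
    using congruence_trace(1)[OF R, of "real_diag d a"] H by (simp add: Q_def)
  also have "\<dots> = complex_of_real (\<Sum>i<d. m i)"
    using congruence_trace(1)[OF Wc, of "real_diag d m"] WW by (simp add: mat_trace_real_diag)
  finally have sums: "(\<Sum>i<d. b i) = (\<Sum>i<d. m i)"
    using of_real_eq_iff by blast
  have "complex_of_real (\<Sum>i<d. \<Sum>j<d. a i * a j * (cmod (Q $$ (i, j)))\<^sup>2) =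
      (\<Sum>i<d. \<Sum>j<d. (a i * Q $$ (i, j)) * (a j * Q $$ (j, i)))"
    unfolding of_real_sum
  proof (intro sum.cong refl)
    fix i j assume "i \<in> {..<d}" "j \<in> {..<d}"
    then have "Q $$ (j, i) = cnj (Q $$ (i, j))"
      by (intro Q_swap) auto
    then show "complex_of_real (a i * a j * (cmod (Q $$ (i, j)))\<^sup>2) =
        (a i * Q $$ (i, j)) * (a j * Q $$ (j, i))"
      unfolding of_real_mult complex_norm_square by (simp only: mult_ac)
  qed
  also have "\<dots> = mat_trace ((real_diag d a * Q) * (real_diag d a * Q))"
    using Q by (subst mat_trace_mult[of _ d]) (simp_all add: DQ_index del: index_mult_mat(1))
  also have "\<dots> = mat_trace ((W * real_diag d m * mat_adjoint W) * (W * real_diag d m * mat_adjoint W))"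
    using congruence_trace(2)[OF R, of "real_diag d a"] H by (simp add: Q_def)
  also have "\<dots> = complex_of_real (\<Sum>i<d. (m i)\<^sup>2)"
    using congruence_trace(2)[OF Wc, of "real_diag d m"] WW
      mat_trace_real_diag[of d "\<lambda>i. (m i)\<^sup>2"] by (simp add: power2_eq_square)
  finally have frob: "(\<Sum>i<d. \<Sum>j<d. a i * a j * (cmod (Q $$ (i, j)))\<^sup>2) = (\<Sum>i<d. (m i)\<^sup>2)"
    using of_real_eq_iff by blast
  have split: "(\<Sum>j<d. a i * a j * (cmod (Q $$ (i, j)))\<^sup>2) =
      (b i)\<^sup>2 + (\<Sum>j\<in>{..<d} - {i}. a i * a j * (cmod (Q $$ (i, j)))\<^sup>2)" if "i < d" for i
    using that by (subst sum.remove[of _ i]) (auto simp: Q_diag b_def power2_eq_square)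
  define off where "off = (\<Sum>i<d. \<Sum>j\<in>{..<d} - {i}. a i * a j * (cmod (Q $$ (i, j)))\<^sup>2)"
  have off_nonneg: "0 \<le> (\<Sum>j\<in>{..<d} - {i}. a i * a j * (cmod (Q $$ (i, j)))\<^sup>2)" if "i < d" for i
    using a that by (intro sum_nonneg) (auto simp: less_imp_le)
  have total: "(\<Sum>i<d. (b i)\<^sup>2) + off = (\<Sum>i<d. (m i)\<^sup>2)"
    using frob split by (simp add: off_def sum.distrib)
  have "m i \<le> b i" if "i < d" "c < m i" for i
  proof -
    have "\<alpha> * a i \<le> normsq (col R i) * a i"
      using colR_bounds(1)[OF that(1)] a[OF that(1)] by (intro mult_right_mono) simp_all
    then show ?thesis
      using above[OF that] by (simp add: b_def mult.commute)
  qed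
  moreover have "b i \<le> m i" if "i < d" "m i < c" for i
  proof -
    have "normsq (col R i) * a i \<le> \<beta> * a i"
      using colR_bounds(2)[OF that(1)] a[OF that(1)] by (intro mult_right_mono) simp_all
    then show ?thesis
      using below[OF that] by (simp add: b_def mult.commute)
  qed
  ultimately have "(\<Sum>i<d. (m i)\<^sup>2) + (\<Sum>i<d. (b i - m i)\<^sup>2) \<le> (\<Sum>i<d. (b i)\<^sup>2)"
    using sums by (intro sum_squares_water_level[of d c m b]) auto
  moreover have "0 \<le> off" "0 \<le> (\<Sum>i<d. (b i - m i)\<^sup>2)"
    unfolding off_def using off_nonneg by (auto intro: sum_nonneg)
  ultimately have zero: "(\<Sum>i<d. (b i - m i)\<^sup>2) = 0" "off = 0"
    using total by linarith+
  have b_eq: "b i = m i" if "i < d" for i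
    using zero(1) that by (simp add: sum_nonneg_eq_0_iff)
  have "(\<Sum>j\<in>{..<d} - {i}. a i * a j * (cmod (Q $$ (i, j)))\<^sup>2) = 0" if "i < d" for i
    using zero(2) that off_nonneg unfolding off_def by (subst (asm) sum_nonneg_eq_0_iff) auto
  moreover have "0 \<le> a i * a j * (cmod (Q $$ (i, j)))\<^sup>2" if "i < d" "j < d" for i j
    using a[OF that(1)] a[OF that(2)] by simp
  ultimately have "a i * a j * (cmod (Q $$ (i, j)))\<^sup>2 = 0" if "i < d" "j < d" "i \<noteq> j" for i j
    using that sum_nonneg_eq_0_iff[of "{..<d} - {i}" "\<lambda>j. a i * a j * (cmod (Q $$ (i, j)))\<^sup>2"]
    by auto
  then have Q_off: "Q $$ (i, j) = 0" if "i < d" "j < d" "i \<noteq> j" for i j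
    using that a[of i] a[of j] by fastforce
  have "Q $$ (i, i) = complex_of_real (m i / a i)" if "i < d" for i
  proof -
    have "normsq (col R i) = m i / a i"
      using b_eq[OF that] a[OF that] by (simp add: b_def field_simps)
    then show ?thesis
      using Q_diag[OF that] by simp
  qed
  then have Q_eq: "Q = real_diag d (\<lambda>i. m i / a i)"
    using Q Q_off by (intro eq_matI) (auto simp: mat_diag_def)
  have UU: "U * mat_adjoint U = 1\<^sub>m d"
    using unitary_right[OF U] .
  have "U * Q * mat_adjoint U = (U * mat_adjoint U) * (mat_adjoint V * V) * (U * mat_adjoint U)"
    using Uc V adjoint_mult[OF V Uc] by (simp add: Q_def R_def assoc)
  also have "\<dots> = mat_adjoint V * V"
    using UU V by simp
  finally show ?thesis
    using Q_eq by simp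
qed

section \<open>Frame operators and admissible perturbations\<close>

lemma frame_op_eq:
  assumes "set F \<subseteq> carrier_vec d"
  shows "frame_op d F = mat_of_cols d F * mat_adjoint (mat_of_cols d F)"
proof (rule eq_matI)
  fix i j
  assume "i < dim_row (mat_of_cols d F * mat_adjoint (mat_of_cols d F))"
    and "j < dim_col (mat_of_cols d F * mat_adjoint (mat_of_cols d F))"
  then have ij: "i < d" "j < d" by simp_all
  have dim: "dim_vec (F ! k) = d" if "k < length F" for k
    using assms that nth_mem[of k F] carrier_vecD by blast
  show "frame_op d F $$ (i, j) = (mat_of_cols d F * mat_adjoint (mat_of_cols d F)) $$ (i, j)"
    using ij dim
    by (simp add: frame_op_def mat_sum_def outer_def scalar_prod_def mat_of_cols_index atLeast0LessThan)
qed (simp_all add: frame_op_def mat_sum_def)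

lemma mat_of_cols_act:
  assumes F: "set F \<subseteq> carrier_vec d" and V: "V \<in> carrier_mat d d"
  shows "mat_of_cols d (act V F) = V * mat_of_cols d F"
proof (rule eq_matI)
  fix i j assume "i < dim_row (V * mat_of_cols d F)" "j < dim_col (V * mat_of_cols d F)"
  then have ij: "i < d" "j < length F" using V by simp_all
  have "F ! j \<in> carrier_vec d"
    using F ij nth_mem[of j F] by blast
  then show "mat_of_cols d (act V F) $$ (i, j) = (V * mat_of_cols d F) $$ (i, j)"
    using ij V by (simp add: act_def mat_of_cols_index)
qed (use V in \<open>simp_all add: act_def\<close>)

lemma frame_op_carrier [simp]: "frame_op d F \<in> carrier_mat d d"
  by (simp add: frame_op_def mat_sum_def)

lemma frame_op_act:
  assumes F: "set F \<subseteq> carrier_vec d" and V: "V \<in> carrier_mat d d"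
  shows "frame_op d (act V F) = V * frame_op d F * mat_adjoint V"
proof -
  let ?M = "mat_of_cols d F"
  have M: "?M \<in> carrier_mat d (length F)" by simp
  have "set (act V F) \<subseteq> carrier_vec d"
    using F V by (auto simp: act_def)
  then have "frame_op d (act V F) = (V * ?M) * mat_adjoint (V * ?M)"
    by (simp add: frame_op_eq mat_of_cols_act[OF F V])
  also have "\<dots> = (V * ?M) * (mat_adjoint ?M * mat_adjoint V)"
    using adjoint_mult[OF V M] by simp
  also have "\<dots> = V * (?M * mat_adjoint ?M) * mat_adjoint V"
  proof -
    have N: "mat_adjoint ?M \<in> carrier_mat (length F) d" "mat_adjoint V \<in> carrier_mat d d"
      using V by simp_all
    have "V * ?M * (mat_adjoint ?M * mat_adjoint V) = V * (?M * (mat_adjoint ?M * mat_adjoint V))"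
      by (rule assoc_mult_mat[OF V M mult_carrier_mat[OF N]])
    also have "?M * (mat_adjoint ?M * mat_adjoint V) = ?M * mat_adjoint ?M * mat_adjoint V"
      by (rule assoc_mult_mat[OF M N, symmetric])
    also have "V * (?M * mat_adjoint ?M * mat_adjoint V) = V * (?M * mat_adjoint ?M) * mat_adjoint V"
      by (rule assoc_mult_mat[OF V mult_carrier_mat[OF M N(1)] N(2), symmetric])
    finally show ?thesis .
  qed
  finally show ?thesis
    by (simp add: frame_op_eq[OF F])
qed

lemma frame_op_hermitian:
  assumes F: "set F \<subseteq> carrier_vec d"
  shows "mat_adjoint (frame_op d F) = frame_op d F"
  unfolding frame_op_eq[OF F]
  by (subst adjoint_mult[of _ d "length F" _ d]) simp_all

text \<open>
  The span of \<open>F\<close> contains \<open>x\<close> itself, so that \<open>x\<close> is orthogonal to itself.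
\<close>

lemma frame_orthogonal_zero:
  assumes F: "is_frame d F" and x: "x \<in> carrier_vec d" and orth: "\<And>f. f \<in> set F \<Longrightarrow> f \<bullet>c x = 0"
  shows "x = 0\<^sub>v d"
proof -
  interpret vec_space "TYPE(complex)" d .
  have Fc: "set F \<subseteq> carrier_vec d" and span: "span (set F) = carrier_vec d"
    using F by (auto simp: is_frame_def)
  obtain c A where A: "x = lincomb c A" "finite A" "A \<subseteq> set F"
    using in_spanE[of x "set F"] x span by auto
  have "x \<bullet>c x = (\<Sum>v\<in>A. (c v \<cdot>\<^sub>v v) \<bullet>c x)"
    unfolding A(1)[unfolded lincomb_def] using A(3) Fc x A(1)
    by (subst finsum_scalar_prod_sum) (auto simp: lincomb_def)
  also have "\<dots> = 0"
    using A(3) Fc x orth by (intro sum.neutral ballI) (subst smult_scalar_prod_distrib[of _ d]; auto)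
  finally show ?thesis
    using x by simp
qed

lemma frame_op_positive_definite:
  assumes F: "is_frame d F" and x: "x \<in> carrier_vec d" "x \<noteq> 0\<^sub>v d"
  shows "0 < Re ((frame_op d F *\<^sub>v x) \<bullet>c x)"
proof -
  let ?M = "mat_of_cols d F"
  define y where "y = mat_adjoint ?M *\<^sub>v x"
  have Fc: "set F \<subseteq> carrier_vec d" using F by (simp add: is_frame_def)
  have M: "?M \<in> carrier_mat d (length F)" by simp
  have y: "y \<in> carrier_vec (length F)"
    using mult_mat_vec_carrier[OF adjoint_carrier[OF M] x(1)] by (simp add: y_def)
  have "frame_op d F *\<^sub>v x = ?M *\<^sub>v y"
    using assoc_mult_mat_vec[OF M adjoint_carrier[OF M] x(1)] by (simp add: y_def frame_op_eq[OF Fc])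
  then have "(frame_op d F *\<^sub>v x) \<bullet>c x = y \<bullet>c y"
    using scalar_prod_adjoint[OF M y x(1)] by (simp add: y_def)
  moreover have "y \<noteq> 0\<^sub>v (length F)"
  proof
    assume y0: "y = 0\<^sub>v (length F)"
    have "f \<bullet>c x = 0" if f: "f \<in> set F" for f
    proof -
      obtain i where i: "i < length F" "f = F ! i" using f by (metis in_set_conv_nth)
      have fc: "f \<in> carrier_vec d" using f Fc by auto
      have "x \<bullet>c f = y $ i"
        using adjoint_mult_vec_index[OF M x(1) i(1)] i fc by (simp add: y_def)
      then show ?thesis
        using y0 i scalar_prod_swap[OF fc x(1)] by simp
    qed
    then show False
      using frame_orthogonal_zero[OF F x(1)] x(2) by blast
  qed
  ultimately show ?thesis
    using normsq_pos[OF y] by (simp add: normsq_def)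
qed

text \<open>
  The supremum in \<open>spectral_norm\<close> is one of real numbers, so it bounds its members only once the set
  is known to be bounded.
\<close>

lemma normsq_mult_vec_bdd:
  assumes A: "A \<in> carrier_mat d d"
  shows "bdd_above ((\<lambda>x. vnorm (A *\<^sub>v x)) ` {x \<in> carrier_vec (dim_col A). vnorm x \<le> 1})"
proof (rule bdd_aboveI2)
  fix x assume "x \<in> {x \<in> carrier_vec (dim_col A). vnorm x \<le> 1}"
  then have x: "x \<in> carrier_vec d" "normsq x \<le> 1"
    using A by (auto simp: vnorm_eq_sqrt)
  have entry: "cmod (x $ j) \<le> 1" if "j < d" for j
  proof -
    have "(cmod (x $ j))\<^sup>2 \<le> (\<Sum>i<d. (cmod (x $ i))\<^sup>2)"
      using that by (intro member_le_sum) auto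
    then have "(cmod (x $ j))\<^sup>2 \<le> 1"
      using x(2) normsq_eq_sum[OF x(1)] by simp
    then show ?thesis
      by (simp add: abs_square_le_1)
  qed
  have "normsq (A *\<^sub>v x) = (\<Sum>i<d. (cmod ((A *\<^sub>v x) $ i))\<^sup>2)"
    using A x by (intro normsq_eq_sum) simp
  also have "\<dots> \<le> (\<Sum>i<d. (\<Sum>j<d. cmod (A $$ (i, j)))\<^sup>2)"
  proof (intro sum_mono power_mono)
    fix i assume i: "i \<in> {..<d}"
    have "(A *\<^sub>v x) $ i = (\<Sum>j<d. A $$ (i, j) * x $ j)"
      using i A x by (simp add: scalar_prod_def atLeast0LessThan)
    then have "cmod ((A *\<^sub>v x) $ i) \<le> (\<Sum>j<d. cmod (A $$ (i, j) * x $ j))"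
      using norm_sum by metis
    also have "\<dots> \<le> (\<Sum>j<d. cmod (A $$ (i, j)))"
      using entry by (intro sum_mono) (simp add: norm_mult mult_left_le)
    finally show "cmod ((A *\<^sub>v x) $ i) \<le> (\<Sum>j<d. cmod (A $$ (i, j)))" .
  qed simp
  finally show "vnorm (A *\<^sub>v x) \<le> sqrt (\<Sum>i<d. (\<Sum>j<d. cmod (A $$ (i, j)))\<^sup>2)"
    by (simp add: vnorm_eq_sqrt)
qed

lemma normsq_mult_vec_le:
  assumes A: "A \<in> carrier_mat d d" and norm: "spectral_norm A \<le> \<delta>" and x: "x \<in> carrier_vec d"
  shows "normsq (A *\<^sub>v x) \<le> \<delta>\<^sup>2 * normsq x"
proof (cases "x = 0\<^sub>v d")
  case True
  then have "A *\<^sub>v x = 0\<^sub>v d" using A by (intro eq_vecI) auto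
  then show ?thesis
    using normsq_eq_0[of "0\<^sub>v d" d] True by simp
next
  case False
  define r where "r = 1 / sqrt (normsq x)"
  have r: "0 < r" "r\<^sup>2 * normsq x = 1"
    using normsq_pos[OF x False] by (simp_all add: r_def power_divide)
  have "vnorm (A *\<^sub>v (complex_of_real r \<cdot>\<^sub>v x)) \<le> spectral_norm A"
    unfolding spectral_norm_def using A x r
    by (intro cSUP_upper normsq_mult_vec_bdd[OF A]) (simp add: vnorm_eq_sqrt normsq_smult)
  also have "A *\<^sub>v (complex_of_real r \<cdot>\<^sub>v x) = complex_of_real r \<cdot>\<^sub>v (A *\<^sub>v x)"
    using A x by (simp add: mult_mat_vec)
  finally have le: "sqrt (r\<^sup>2 * normsq (A *\<^sub>v x)) \<le> \<delta>"
    using norm by (simp add: vnorm_eq_sqrt normsq_smult)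
  have "0 \<le> sqrt (r\<^sup>2 * normsq (A *\<^sub>v x))"
    by simp
  then have "r\<^sup>2 * normsq (A *\<^sub>v x) \<le> \<delta>\<^sup>2"
    using le power_mono[OF le, of 2] by simp
  also have "\<dots> = r\<^sup>2 * (\<delta>\<^sup>2 * normsq x)"
    using r by (simp add: mult.left_commute)
  finally show ?thesis
    using r by simp
qed

text \<open>
  Let \<open>E = V\<^sup>* V - I\<close>, so that \<open>\<langle>E x, x\<rangle> = |V x|\<^sup>2 - |x|\<^sup>2\<close>.  Expanding \<open>|E x \<minusplus> \<delta> x|\<^sup>2 \<ge> 0\<close> with
  \<open>|E x| \<le> \<delta> |x|\<close> gives \<open>\<plusminus> \<langle>E x, x\<rangle> \<le> \<delta> |x|\<^sup>2\<close>.
\<close>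

lemma perturbation_norm_bounds:
  assumes V: "V \<in> carrier_mat d d" and norm: "spectral_norm (mat_adjoint V * V - 1\<^sub>m d) \<le> \<delta>"
    and \<delta>: "0 < \<delta>" and x: "x \<in> carrier_vec d"
  shows "(1 - \<delta>) * normsq x \<le> normsq (V *\<^sub>v x)" and "normsq (V *\<^sub>v x) \<le> (1 + \<delta>) * normsq x"
proof -
  define E where "E = mat_adjoint V * V - 1\<^sub>m d"
  have E: "E \<in> carrier_mat d d" using V by (auto simp: E_def intro: minus_carrier_mat)
  have Ex: "E *\<^sub>v x \<in> carrier_vec d" using E x by simp
  have "E *\<^sub>v x = mat_adjoint V *\<^sub>v (V *\<^sub>v x) - x"
    using V x by (simp add: E_def minus_mult_distrib_mat_vec[of _ d d] assoc_mult_mat_vec[of _ d d _ d])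
  then have "(E *\<^sub>v x) \<bullet>c x = (mat_adjoint V *\<^sub>v (V *\<^sub>v x)) \<bullet>c x - x \<bullet>c x"
    using V x by (simp add: minus_scalar_prod_distrib[of _ d])
  also have "(mat_adjoint V *\<^sub>v (V *\<^sub>v x)) \<bullet>c x = (V *\<^sub>v x) \<bullet>c (V *\<^sub>v x)"
    using scalar_prod_adjoint[of "mat_adjoint V" d d "V *\<^sub>v x" x] V x by simp
  finally have form: "Re ((E *\<^sub>v x) \<bullet>c x) = normsq (V *\<^sub>v x) - normsq x"
    by (simp add: normsq_def)
  have sq: "0 \<le> 2 * (\<delta>\<^sup>2 * normsq x) - 2 * r * (normsq (V *\<^sub>v x) - normsq x)" if "r\<^sup>2 = \<delta>\<^sup>2" for r
    using normsq_minus_smult[OF Ex x, of r] normsq_nonneg[of "E *\<^sub>v x - complex_of_real r \<cdot>\<^sub>v x"]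
      normsq_mult_vec_le[OF E norm[folded E_def] x] form that by simp
  have "0 \<le> \<delta> * (\<delta> * normsq x - (normsq (V *\<^sub>v x) - normsq x))"
    using sq[of \<delta>] by (simp add: power2_eq_square algebra_simps)
  then have "0 \<le> \<delta> * normsq x - (normsq (V *\<^sub>v x) - normsq x)"
    using \<delta> by (simp only: zero_le_mult_iff) linarith
  then show "normsq (V *\<^sub>v x) \<le> (1 + \<delta>) * normsq x"
    by (simp add: algebra_simps)
  have "0 \<le> \<delta> * (\<delta> * normsq x + (normsq (V *\<^sub>v x) - normsq x))"
    using sq[of "- \<delta>"] by (simp add: power2_eq_square algebra_simps)
  then have "0 \<le> \<delta> * normsq x + (normsq (V *\<^sub>v x) - normsq x)"
    using \<delta> by (simp only: zero_le_mult_iff) linarith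
  then show "(1 - \<delta>) * normsq x \<le> normsq (V *\<^sub>v x)"
    by (simp add: algebra_simps)
qed

lemma spectral_norm_diagonalized_le:
  assumes U: "unitary d U" and h: "\<And>i. i < d \<Longrightarrow> \<bar>h i - 1\<bar> \<le> \<delta>" and \<delta>: "0 < \<delta>"
  shows "spectral_norm (U * real_diag d h * mat_adjoint U - 1\<^sub>m d) \<le> \<delta>"
proof -
  have Uc: "U \<in> carrier_mat d d" using U by (simp add: unitary_def)
  have E: "U * real_diag d h * mat_adjoint U - 1\<^sub>m d = U * real_diag d (\<lambda>i. h i - 1) * mat_adjoint U"
  proof -
    have "real_diag d (\<lambda>i. h i - 1) = real_diag d h - 1\<^sub>m d"
      by (rule eq_matI) (auto simp: mat_diag_def)
    then have "U * real_diag d (\<lambda>i. h i - 1) * mat_adjoint U =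
        U * real_diag d h * mat_adjoint U - U * mat_adjoint U"
      using Uc by (simp add: mult_minus_distrib_mat[of _ d d _ d] 
          minus_mult_distrib_mat[of "U * real_diag d h" d d U "mat_adjoint U" d])
    then show ?thesis
      using unitary_right[OF U] by simp
  qed
  show ?thesis
    unfolding spectral_norm_def E
  proof (rule cSUP_least)
    show "{x \<in> carrier_vec (dim_col (U * real_diag d (\<lambda>i. h i - 1) * mat_adjoint U)). vnorm x \<le> 1} \<noteq> {}"
      using normsq_eq_0[of "0\<^sub>v (dim_row U)" "dim_row U"] by (auto simp: vnorm_eq_sqrt intro!: exI[of _ "0\<^sub>v (dim_row U)"])
    fix x assume "x \<in> {x \<in> carrier_vec (dim_col (U * real_diag d (\<lambda>i. h i - 1) * mat_adjoint U)). vnorm x \<le> 1}"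
    then have x: "x \<in> carrier_vec d" "normsq x \<le> 1"
      using Uc by (auto simp: vnorm_eq_sqrt)
    define y where "y = mat_adjoint U *\<^sub>v x"
    have y: "y \<in> carrier_vec d" using Uc x by (simp add: y_def)
    have Dy: "real_diag d (\<lambda>i. h i - 1) *\<^sub>v y \<in> carrier_vec d"
      using y by simp
    have "normsq ((U * real_diag d (\<lambda>i. h i - 1) * mat_adjoint U) *\<^sub>v x) =
        normsq (U *\<^sub>v (real_diag d (\<lambda>i. h i - 1) *\<^sub>v y))"
      using Uc x by (simp add: y_def assoc_mult_mat_vec[of _ d d _ d])
    also have "\<dots> = normsq (real_diag d (\<lambda>i. h i - 1) *\<^sub>v y)"
      by (rule normsq_unitary[OF U Dy])
    also have "\<dots> = (\<Sum>i<d. (cmod (complex_of_real (h i - 1) * y $ i))\<^sup>2)"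
      unfolding real_diag_mult_vec[OF y] by (subst normsq_eq_sum[of _ d]) simp_all
    also have "\<dots> = (\<Sum>i<d. (h i - 1)\<^sup>2 * (cmod (y $ i))\<^sup>2)"
      by (intro sum.cong refl) (simp add: norm_mult power_mult_distrib del: of_real_diff)
    also have "\<dots> \<le> (\<Sum>i<d. \<delta>\<^sup>2 * (cmod (y $ i))\<^sup>2)"
      using h \<delta> by (intro sum_mono mult_right_mono) (auto simp: abs_le_square_iff[symmetric])
    also have "\<dots> = \<delta>\<^sup>2 * normsq x"
      using normsq_unitary[OF unitary_adjoint[OF U] x(1)] normsq_eq_sum[OF y]
      by (simp add: y_def sum_distrib_left)
    also have "\<dots> \<le> \<delta>\<^sup>2"
      using x by (simp add: mult_left_le)
    finally show "vnorm ((U * real_diag d (\<lambda>i. h i - 1) * mat_adjoint U) *\<^sub>v x) \<le> \<delta>"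
      using \<delta> by (simp add: vnorm_eq_sqrt real_le_lsqrt)
  qed
qed

lemma det_diagonalized:
  assumes U: "unitary d U"
  shows "det (U * real_diag d h * mat_adjoint U) = complex_of_real (\<Prod>i<d. h i)"
proof -
  have Uc: "U \<in> carrier_mat d d" using U by (simp add: unitary_def)
  have "det U * det (mat_adjoint U) = 1"
    using det_mult[OF Uc, of "mat_adjoint U"] Uc unitary_right[OF U] by simp
  moreover have "det (real_diag d h) = (\<Prod>i<d. complex_of_real (h i))"
    by (subst det_upper_triangular[of _ d])
      (auto simp: upper_triangular_def mat_diag_def prod_list_diag_prod atLeast0LessThan)
  moreover have "det (U * real_diag d h * mat_adjoint U) = det U * det (real_diag d h) * det (mat_adjoint U)"
    using Uc by (simp add: det_mult[of _ d])
  ultimately show ?thesis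
    by (simp add: mult.commute mult.left_commute)
qed

section \<open>The optimal spectrum\<close>

lemma sum_list_ln:
  fixes x :: "real list"
  assumes "\<And>i. i < length x \<Longrightarrow> 0 < x ! i"
  shows "sum_list (map ln x) = ln (\<Prod>i<length x. x ! i)"
proof -
  have "x ! i \<noteq> 0" if "i < length x" for i
    using assms[OF that] by simp
  then show ?thesis
    by (subst ln_prod) (simp_all add: sum_list_nth_lessThan)
qed

text \<open>
  The part of the theorem that concerns only the eigenvalue lists: under \<open>z \<mapsto> ln (z / (1 - \<delta>))\<close> the
  multiplicative bounds \<open>(1 - \<delta>) a\<^sub>i \<le> g\<^sub>i \<le> (1 + \<delta>) a\<^sub>i\<close> and \<open>\<Prod> g\<^sub>i \<ge> s \<cdot> \<Prod> a\<^sub>i\<close> become membership in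
  \<open>Lambda_set t \<epsilon> lam\<close>.  The exponential of the water level, times \<open>1 - \<delta>\<close>, is the level at which \<open>\<mu>\<close>
  is clamped.
\<close>

lemma optimal_spectrum:
  fixes a lam \<mu> :: "real list"
  assumes len: "length a = d" and sorted: "decr a = a" and a_pos: "\<forall>i<d. 0 < a ! i"
    and \<delta>: "0 < \<delta>" "\<delta> < 1" and s: "0 < s" "(1 - \<delta>) ^ d \<le> s" "s \<le> (1 + \<delta>) ^ d"
    and lam: "lam = map ln a"
    and t: "t = ln (s * (\<Prod>i<d. a ! i) / (1 - \<delta>) ^ d)"
    and \<epsilon>: "\<epsilon> = ln ((1 + \<delta>) / (1 - \<delta>))"
    and \<mu>: "\<mu> = map (\<lambda>r. (1 - \<delta>) * exp r) (rho t \<epsilon> lam)"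
  shows "decr lam = lam" and "sum_list lam \<le> t" and "0 < \<epsilon>"
    and "length \<mu> = d" and "decr \<mu> = \<mu>"
    and "\<And>i. i < d \<Longrightarrow> (1 - \<delta>) * a ! i \<le> \<mu> ! i"
    and "\<And>i. i < d \<Longrightarrow> \<mu> ! i \<le> (1 + \<delta>) * a ! i"
    and "(\<Prod>i<d. \<mu> ! i) = s * (\<Prod>i<d. a ! i)"
    and "\<exists>c. \<forall>i<d. (c < \<mu> ! i \<longrightarrow> \<mu> ! i \<le> (1 - \<delta>) * a ! i) \<and> (\<mu> ! i < c \<longrightarrow> (1 + \<delta>) * a ! i \<le> \<mu> ! i)"
    and "\<And>g k. length g = d \<Longrightarrow> decr g = g \<Longrightarrow>
      \<forall>i<d. (1 - \<delta>) * a ! i \<le> g ! i \<and> g ! i \<le> (1 + \<delta>) * a ! i \<Longrightarrow>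
      s * (\<Prod>i<d. a ! i) \<le> (\<Prod>i<d. g ! i) \<Longrightarrow> k \<le> d \<Longrightarrow>
      (\<Prod>i<k. \<mu> ! i) \<le> (\<Prod>i<k. g ! i)"
proof -
  have pos: "0 < a ! i" if "i < d" for i
    using a_pos that by simp
  have A: "0 < (\<Prod>i<d. a ! i)"
    using pos by (intro prod_pos) auto
  have sum_lam: "sum_list lam = ln (\<Prod>i<d. a ! i)"
    using sum_list_ln[of a] pos len by (simp add: lam)
  have t_eq: "t = sum_list lam + ln s - d * ln (1 - \<delta>)"
    using A s \<delta> by (simp add: t sum_lam ln_mult_pos ln_div ln_realpow del: prod_zero_iff)
  have \<epsilon>_eq: "\<epsilon> = ln (1 + \<delta>) - ln (1 - \<delta>)"
    using \<delta> by (simp add: \<epsilon> ln_div)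
  have len_lam: "length lam = d"
    using len by (simp add: lam)
  have lam_nth: "lam ! i = ln (a ! i)" if "i < d" for i
    using that len by (simp add: lam)
  show lam_sorted: "decr lam = lam"
    using sorted len len_lam pos unfolding decr_eq_iff
    by (metis lam_nth le_less_trans ln_le_cancel_iff)
  have "ln ((1 - \<delta>) ^ d) \<le> ln s" "ln s \<le> ln ((1 + \<delta>) ^ d)"
    using s \<delta> by simp_all
  then have s_ln: "d * ln (1 - \<delta>) \<le> ln s" "ln s \<le> d * ln (1 + \<delta>)"
    using \<delta> by (simp_all add: ln_realpow)
  show sum_le: "sum_list lam \<le> t"
    using s_ln by (simp add: t_eq)
  show \<epsilon>_pos: "0 < \<epsilon>"
    using \<delta> by (simp add: \<epsilon>_eq)
  have "t \<le> sum_list lam + real (length lam) * \<epsilon>"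
    using s_ln by (simp add: t_eq \<epsilon>_eq len_lam right_diff_distrib)
  then obtain c where c: "sum_list (water_fill c \<epsilon> lam) = t"
    using ex_water_level[OF \<epsilon>_pos sum_le] by blast
  define u where "u = water_fill c \<epsilon> lam"
  have rho_u: "rho t \<epsilon> lam = u"
    unfolding u_def by (rule rho_eq_water_fill[OF lam_sorted \<epsilon>_pos c])
  have len_u: "length u = d"
    by (simp add: u_def len_lam)
  have u_nth: "u ! i = max (lam ! i) (min c (lam ! i + \<epsilon>))" if "i < d" for i
    using that by (simp add: u_def water_fill_nth len_lam)
  have \<mu>_nth: "\<mu> ! i = (1 - \<delta>) * exp (u ! i)" if "i < d" for i
    using that by (simp add: \<mu> rho_u len_u)
  have exp_lam: "exp (lam ! i) = a ! i" if "i < d" for i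
    using pos[OF that] lam_nth[OF that] by simp
  have exp_upper: "(1 - \<delta>) * exp (lam ! i + \<epsilon>) = (1 + \<delta>) * a ! i" if "i < d" for i
    using \<delta> that by (simp add: exp_add exp_lam \<epsilon>)
  show len_\<mu>: "length \<mu> = d"
    by (simp add: \<mu> rho_u len_u)
  have "decr u = u"
    unfolding u_def by (rule decr_water_fill[OF lam_sorted])
  then show "decr \<mu> = \<mu>"
    using \<delta> unfolding decr_eq_iff len_\<mu> len_u by (auto simp: \<mu>_nth)
  show "(1 - \<delta>) * a ! i \<le> \<mu> ! i" if "i < d" for i
    using \<delta> that by (simp add: \<mu>_nth exp_lam[symmetric] u_nth)
  show "\<mu> ! i \<le> (1 + \<delta>) * a ! i" if "i < d" for i
    using \<delta> \<epsilon>_pos that by (simp add: \<mu>_nth exp_upper[symmetric] u_nth)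
  have prod_exp: "(\<Prod>i<k. (1 - \<delta>) * exp (f i)) = (1 - \<delta>) ^ k * exp (\<Sum>i<k. f i)" for f :: "nat \<Rightarrow> real" and k
    by (simp add: prod.distrib exp_sum)
  have prod_\<mu>: "(\<Prod>i<k. \<mu> ! i) = (1 - \<delta>) ^ k * exp (\<Sum>i<k. u ! i)" if "k \<le> d" for k
    using that prod_exp[of "\<lambda>i. u ! i" k] by (simp add: \<mu>_nth)
  have "(\<Sum>i<d. u ! i) = t"
    using c sum_list_nth_lessThan[of u] len_u by (simp add: u_def)
  then show "(\<Prod>i<d. \<mu> ! i) = s * (\<Prod>i<d. a ! i)"
    using \<delta> s A by (simp add: prod_\<mu> t)
  show "\<exists>c. \<forall>i<d. (c < \<mu> ! i \<longrightarrow> \<mu> ! i \<le> (1 - \<delta>) * a ! i) \<and> (\<mu> ! i < c \<longrightarrow> (1 + \<delta>) * a ! i \<le> \<mu> ! i)"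
  proof (intro exI[of _ "(1 - \<delta>) * exp c"] allI impI conjI)
    fix i assume i: "i < d"
    show "\<mu> ! i \<le> (1 - \<delta>) * a ! i" if "(1 - \<delta>) * exp c < \<mu> ! i"
      using \<delta> that i by (auto simp: \<mu>_nth exp_lam[symmetric] u_nth)
    show "(1 + \<delta>) * a ! i \<le> \<mu> ! i" if "\<mu> ! i < (1 - \<delta>) * exp c"
      using \<delta> that i by (auto simp: \<mu>_nth exp_upper[symmetric] u_nth)
  qed
  show "(\<Prod>i<k. \<mu> ! i) \<le> (\<Prod>i<k. g ! i)"
    if g: "length g = d" "decr g = g"
      and bounds: "\<forall>i<d. (1 - \<delta>) * a ! i \<le> g ! i \<and> g ! i \<le> (1 + \<delta>) * a ! i"
      and det: "s * (\<Prod>i<d. a ! i) \<le> (\<Prod>i<d. g ! i)" and k: "k \<le> d" for g k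
  proof -
    have lower: "(1 - \<delta>) * a ! i \<le> g ! i" and upper: "g ! i \<le> (1 + \<delta>) * a ! i" if "i < d" for i
      using bounds that by simp_all
    define \<gamma> where "\<gamma> = map (\<lambda>z. ln (z / (1 - \<delta>))) g"
    have g_pos: "0 < g ! i" if "i < d" for i
      using lower[OF that] pos[OF that] \<delta> by (smt (verit) mult_pos_pos)
    have \<gamma>_nth: "\<gamma> ! i = ln (g ! i) - ln (1 - \<delta>)" if "i < d" for i
      using that g g_pos[OF that] \<delta> by (simp add: \<gamma>_def ln_div)
    have g_exp: "g ! i = (1 - \<delta>) * exp (\<gamma> ! i)" if "i < d" for i
      using that g g_pos[OF that] \<delta> by (simp add: \<gamma>_def)
    have len_\<gamma>: "length \<gamma> = d"
      using g by (simp add: \<gamma>_def)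
    have \<gamma>_sorted: "decr \<gamma> = \<gamma>"
      using g g_pos unfolding decr_eq_iff len_\<gamma> by (auto simp: \<gamma>_nth)
    have prod_g: "(\<Prod>i<k. g ! i) = (1 - \<delta>) ^ k * exp (\<Sum>i<k. \<gamma> ! i)" if "k \<le> d" for k
      using that prod_exp[of "\<lambda>i. \<gamma> ! i" k] by (simp add: g_exp)
    have "exp t \<le> exp (sum_list \<gamma>)"
      using det prod_g[of d] \<delta> s A sum_list_nth_lessThan[of \<gamma>]
      by (simp add: t len_\<gamma> divide_le_eq mult.commute)
    moreover have "lam ! i \<le> \<gamma> ! i" if "i < d" for i
    proof -
      have "ln ((1 - \<delta>) * a ! i) \<le> ln (g ! i)"
        using lower[OF that] pos[OF that] g_pos[OF that] \<delta> by simp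
      then show ?thesis
        using pos[OF that] \<delta> by (simp add: \<gamma>_nth[OF that] lam_nth[OF that] ln_mult)
    qed
    moreover have "\<gamma> ! i \<le> lam ! i + \<epsilon>" if "i < d" for i
    proof -
      have "ln (g ! i) \<le> ln ((1 + \<delta>) * a ! i)"
        using upper[OF that] pos[OF that] g_pos[OF that] \<delta> by simp
      then show ?thesis
        using pos[OF that] \<delta> by (simp add: \<gamma>_nth[OF that] lam_nth[OF that] ln_mult \<epsilon>_eq)
    qed
    ultimately have "\<gamma> \<in> Lambda_set t \<epsilon> lam"
      by (simp add: Lambda_set_iff len_lam len_\<gamma>)
    then have "u \<prec>\<^sub>w \<gamma>"
      unfolding u_def by (rule water_fill_submajorized[OF lam_sorted \<epsilon>_pos c])
    then have "(\<Sum>i<k. u ! i) \<le> (\<Sum>i<k. \<gamma> ! i)"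
      using k \<open>decr u = u\<close> \<gamma>_sorted len_u by (cases "k = 0") (auto simp: submajorized_def)
    then show ?thesis
      using \<delta> k by (simp add: prod_\<mu> prod_g)
  qed
qed

lemma eq_iff_partial_products:
  fixes x y :: "real list"
  assumes len: "length x = d" "length y = d" and pos: "\<And>i. i < d \<Longrightarrow> 0 < x ! i"
  shows "(\<forall>k\<in>{1..d}. (\<Prod>i<k. x ! i) = (\<Prod>i<k. y ! i)) \<longleftrightarrow> y = x"
proof
  assume *: "\<forall>k\<in>{1..d}. (\<Prod>i<k. x ! i) = (\<Prod>i<k. y ! i)"
  have prods: "(\<Prod>i<k. x ! i) = (\<Prod>i<k. y ! i)" if "k \<le> d" for k
    using * that by (cases "k = 0") auto
  have "y ! k = x ! k" if "k < d" for k
  proof -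
    define p where "p = (\<Prod>i<k. x ! i)"
    have "0 < p"
      unfolding p_def using pos that by (intro prod_pos) auto
    moreover have "p * x ! k = p * y ! k"
      using prods[of k] prods[of "Suc k"] that by (simp add: p_def del: mult_cancel_left)
    ultimately show ?thesis
      by simp
  qed
  then show "y = x"
    using len by (intro nth_equalityI) auto
qed simp

lemma real_diag_cong: "(\<And>i. i < d \<Longrightarrow> g i = h i) \<Longrightarrow> real_diag d g = real_diag d h"
  by (intro eq_matI) (auto simp: mat_diag_def)

lemma diagonalized_mult:
  assumes U: "unitary d U"
  shows "(U * real_diag d g * mat_adjoint U) * (U * real_diag d h * mat_adjoint U) =
    U * real_diag d (\<lambda>i. g i * h i) * mat_adjoint U"
proof -
  note assoc = assoc_mult_mat[of _ d d _ d _ d]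
  have Uc: "U \<in> carrier_mat d d" "mat_adjoint U * U = 1\<^sub>m d"
    using U by (simp_all add: unitary_def)
  have "(U * real_diag d g * mat_adjoint U) * (U * real_diag d h * mat_adjoint U) =
      U * (real_diag d g * ((mat_adjoint U * U) * (real_diag d h * mat_adjoint U)))"
    using Uc(1) by (simp add: assoc)
  also have "\<dots> = U * ((real_diag d g * real_diag d h) * mat_adjoint U)"
    using Uc by (simp add: assoc del: mat_diag_diag)
  also have "\<dots> = U * real_diag d (\<lambda>i. g i * h i) * mat_adjoint U"
    using Uc by (simp add: assoc)
  finally show ?thesis .
qed

lemma diagonalized_adjoint:
  assumes "U \<in> carrier_mat d d"
  shows "mat_adjoint (U * real_diag d h * mat_adjoint U) = U * real_diag d h * mat_adjoint U"
  using assms adjoint_mult[of "U * real_diag d h" d d "mat_adjoint U" d] adjoint_mult[of U d d "real_diag d h" d]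
  by (simp add: assoc_mult_mat[of _ d d _ d _ d])

lemma diagonalized_one:
  assumes "unitary d U" and "\<And>i. i < d \<Longrightarrow> h i = 1"
  shows "U * real_diag d h * mat_adjoint U = 1\<^sub>m d"
proof -
  have "real_diag d h = 1\<^sub>m d"
    using assms(2) by (intro eq_matI) (auto simp: mat_diag_def)
  moreover have "U \<in> carrier_mat d d"
    using assms(1) by (simp add: unitary_def)
  ultimately show ?thesis
    using unitary_right[OF assms(1)] by simp
qed

lemma positive_definite_eigenvalues:
  assumes U: "unitary d U" and i: "i < d"
    and form: "\<And>x. x \<in> carrier_vec d \<Longrightarrow> x \<noteq> 0\<^sub>v d \<Longrightarrow>
      0 < Re (((U * real_diag d h * mat_adjoint U) *\<^sub>v x) \<bullet>c x)"
  shows "0 < h i"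
proof -
  have Uc: "U \<in> carrier_mat d d" "mat_adjoint U * U = 1\<^sub>m d"
    using U by (simp_all add: unitary_def)
  define x where "x = U *\<^sub>v unit_vec d i"
  have x: "x \<in> carrier_vec d" using Uc by (simp add: x_def)
  have Ux: "mat_adjoint U *\<^sub>v x = unit_vec d i"
    using Uc assoc_mult_mat_vec[of "mat_adjoint U" d d U d "unit_vec d i"] by (simp add: x_def)
  have "normsq x = 1"
    unfolding x_def using normsq_unitary[OF U, of "unit_vec d i"] i by (simp add: normsq_def)
  then have "x \<noteq> 0\<^sub>v d"
    using normsq_eq_0[OF x] by auto
  then have "0 < (\<Sum>j<d. h j * (cmod (unit_vec d i $ j))\<^sup>2)"
    using form[OF x] form_diagonalized[OF U x, of h] by (simp add: Ux)
  also have "\<dots> = (\<Sum>j<d. if j = i then h j else 0)"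
    using i by (intro sum.cong) auto
  also have "\<dots> = h i"
    using i by simp
  finally show ?thesis .
qed

text \<open>
  Membership of \<open>act V F\<close> provides some admissible \<open>V'\<close> with \<open>act V' F = act V F\<close>.  Then \<open>V' = V\<close>,
  because both have the same product with the invertible matrix \<open>frame_op d F\<close>.
\<close>

lemma perturbation_conditions:
  assumes F: "is_frame d F" and V: "V \<in> carrier_mat d d" and mem: "act V F \<in> perturbations d s \<delta> F"
    and det: "det (frame_op d F) \<noteq> 0"
  shows "invertible_mat V" and "spectral_norm (mat_adjoint V * V - 1\<^sub>m d) \<le> \<delta>"
    and "s \<le> Re (det (mat_adjoint V * V))"
proof -
  obtain V' where V': "act V F = act V' F" "V' \<in> carrier_mat d d" "invertible_mat V'"
      "spectral_norm (mat_adjoint V' * V' - 1\<^sub>m d) \<le> \<delta>" "s \<le> Re (det (mat_adjoint V' * V'))"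
    using mem by (auto simp: perturbations_def)
  let ?M = "mat_of_cols d F" and ?S = "frame_op d F"
  have Fc: "set F \<subseteq> carrier_vec d" using F by (simp add: is_frame_def)
  have M: "?M \<in> carrier_mat d (length F)" by simp
  have VS: "X * ?S = mat_of_cols d (act X F) * mat_adjoint ?M" if "X \<in> carrier_mat d d" for X
    using assoc_mult_mat[OF that M adjoint_carrier[OF M]]
    by (simp add: frame_op_eq[OF Fc] mat_of_cols_act[OF Fc that])
  obtain T where T: "T \<in> carrier_mat d d" "?S * T = 1\<^sub>m d"
    using det_non_zero_imp_unit[OF frame_op_carrier det] unfolding Units_def ring_mat_simps by blast
  have cancel: "X * ?S * T = X" if "X \<in> carrier_mat d d" for X
    using assoc_mult_mat[OF that frame_op_carrier T(1), of F] T that by simp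
  have "V = V'"
    using cancel[OF V] cancel[OF V'(2)] VS[OF V] VS[OF V'(2)] V'(1) by metis
  then show "invertible_mat V" "spectral_norm (mat_adjoint V * V - 1\<^sub>m d) \<le> \<delta>"
    "s \<le> Re (det (mat_adjoint V * V))"
    using V' by simp_all
qed

lemma eigvals_desc_similar: "similar_mat A B \<Longrightarrow> eigvals_desc A = eigvals_desc B"
  by (simp add: eigvals_desc_def char_poly_similar)

lemma map_nth_decr: "length x = d \<Longrightarrow> decr x = x \<Longrightarrow> decr (map (\<lambda>i. x ! i) [0..<d]) = x"
  by (metis map_nth)

theorem theorem5p5:
  fixes d :: nat and F :: "complex vec list"
    and s \<delta> t \<epsilon> :: real and lam \<mu> :: "real list"
  assumes "is_frame d F"
    and "0 < \<delta>" and "\<delta> < 1"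
    and "0 < s" and "(1 - \<delta>) ^ d \<le> s" and "s \<le> (1 + \<delta>) ^ d"
    and "lam = map ln (eigvals_desc (frame_op d F))"
    and "t = ln (s * Re (det (frame_op d F)) / (1 - \<delta>) ^ d)"
    and "\<epsilon> = ln ((1 + \<delta>) / (1 - \<delta>))"
    and "\<mu> = map (\<lambda>r. (1 - \<delta>) * exp r) (rho t \<epsilon> lam)"
  shows
    "lam = decr lam \<and> sum_list lam \<le> t \<and> 0 < \<epsilon> \<and> \<mu> = decr \<mu> \<and>
     (\<exists>V\<^sub>0 \<in> carrier_mat d d. act V\<^sub>0 F \<in> perturbations d s \<delta> F \<and>
        eigvals_desc (frame_op d (act V\<^sub>0 F)) = \<mu>) \<and>
     (\<forall>V \<in> carrier_mat d d. act V F \<in> perturbations d s \<delta> F \<longrightarrow>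
        (\<forall>k \<in> {1..d}. (\<Prod>i<k. \<mu> ! i) \<le> (\<Prod>i<k. eigvals_desc (frame_op d (act V F)) ! i))) \<and>
     (\<forall>V \<in> carrier_mat d d. act V F \<in> perturbations d s \<delta> F \<longrightarrow>
        ((\<forall>k \<in> {1..d}. (\<Prod>i<k. \<mu> ! i) = (\<Prod>i<k. eigvals_desc (frame_op d (act V F)) ! i))
           \<longleftrightarrow> eigvals_desc (frame_op d (act V F)) = \<mu>) \<and>
        ((\<forall>k \<in> {1..d}. (\<Prod>i<k. \<mu> ! i) = (\<Prod>i<k. eigvals_desc (frame_op d (act V F)) ! i))
           \<longleftrightarrow> det (mat_adjoint V * V) = of_real s \<and>
              (\<exists>vs. orthonormal_basis d vs \<and>
                 frame_op d F =
                   mat_sum d d (\<lambda>i. of_real (eigvals_desc (frame_op d F) ! i) \<cdot>\<^sub>m outer (vs ! i) (vs ! i)) \<and>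
                 mat_adjoint V * V =
                   mat_sum d d (\<lambda>i. of_real (\<mu> ! i / eigvals_desc (frame_op d F) ! i)
                     \<cdot>\<^sub>m outer (vs ! i) (vs ! i)))))"
proof -
  note \<delta> = \<open>0 < \<delta>\<close> \<open>\<delta> < 1\<close>
  have Fc: "set F \<subseteq> carrier_vec d" using assms(1) by (simp add: is_frame_def)
  define S where "S = frame_op d F"
  define a where "a = eigvals_desc S"
  have S: "S \<in> carrier_mat d d" "mat_adjoint S = S"
    using frame_op_hermitian[OF Fc] by (simp_all add: S_def)
  obtain us where us: "orthonormal_basis d us"
    and S_us: "S = mat_of_cols d us * real_diag d (\<lambda>i. a ! i) * mat_adjoint (mat_of_cols d us)"
    using hermitian_spectral_decomposition[OF S] by (auto simp: a_def)
  have a_len: "length a = d" and a_sorted: "decr a = a"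
    using hermitian_spectral_decomposition[OF S] by (auto simp: a_def)
  define U where "U = mat_of_cols d us"
  have U: "unitary d U" and S_U: "S = U * real_diag d (\<lambda>i. a ! i) * mat_adjoint U"
    using unitary_orthonormal_basis[OF us] S_us by (simp_all add: U_def)
  have Uc: "U \<in> carrier_mat d d" using U by (simp add: unitary_def)
  have a_pos: "0 < a ! i" if "i < d" for i
    using positive_definite_eigenvalues[OF U that, of "\<lambda>i. a ! i"]
      frame_op_positive_definite[OF assms(1)] by (simp add: S_U[symmetric] S_def)
  have det_S: "det S = complex_of_real (\<Prod>i<d. a ! i)"
    unfolding S_U by (rule det_diagonalized[OF U])
  have a_prod: "0 < (\<Prod>i<d. a ! i)"
    using a_pos by (intro prod_pos) auto
  have t: "t = ln (s * (\<Prod>i<d. a ! i) / (1 - \<delta>) ^ d)"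
    using assms(8) det_S by (simp only: S_def Re_complex_of_real)
  have lam: "lam = map ln a"
    using assms(7) by (simp add: a_def S_def)
  have "\<forall>i<d. 0 < a ! i" using a_pos by simp
  note opt = optimal_spectrum[OF a_len a_sorted this \<delta> assms(4-6) lam t assms(9) assms(10)]
  have \<mu>_len: "length \<mu> = d" and \<mu>_sorted: "decr \<mu> = \<mu>"
    using opt(4,5) by blast+
  have \<mu>_pos: "0 < \<mu> ! i" if "i < d" for i
    using opt(6)[OF that] a_pos[OF that] \<delta> by (smt (verit) mult_pos_pos)
  have decr_nth: "x ! j \<le> x ! i" if "decr x = x" "length x = d" "i \<le> j" "j < d" for x i j
    using that decr_eq_iff[of x] by blast
  have outer_form: "mat_sum d d (\<lambda>i. of_real (h i) \<cdot>\<^sub>m outer (vs ! i) (vs ! i)) =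
      mat_of_cols d vs * real_diag d h * mat_adjoint (mat_of_cols d vs)"
    if "orthonormal_basis d vs" for vs h
    using that by (intro mat_sum_outer) (simp_all add: orthonormal_basis_def)

  have attained: "\<exists>V\<^sub>0 \<in> carrier_mat d d. act V\<^sub>0 F \<in> perturbations d s \<delta> F \<and>
      eigvals_desc (frame_op d (act V\<^sub>0 F)) = \<mu>"
  proof -
    \<comment> \<open>With \<open>V = U diag(r) U\<^sup>*\<close> the eigenvalues of \<open>V S V\<^sup>*\<close> are \<open>r\<^sub>i\<^sup>2 a\<^sub>i\<close>.\<close>
    define r where "r i = sqrt (\<mu> ! i / a ! i)" for i
    have r: "0 < r i" "r i * r i = \<mu> ! i / a ! i" if "i < d" for i
      using a_pos[OF that] \<mu>_pos[OF that] by (simp_all add: r_def)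
    define X where "X = U * real_diag d r * mat_adjoint U"
    have X: "X \<in> carrier_mat d d" "mat_adjoint X = X"
      using Uc diagonalized_adjoint[OF Uc] by (simp_all add: X_def)
    have XX: "mat_adjoint X * X = U * real_diag d (\<lambda>i. \<mu> ! i / a ! i) * mat_adjoint U"
      unfolding X(2) using diagonalized_mult[OF U, of r r] real_diag_cong[of d "\<lambda>i. r i * r i" "\<lambda>i. \<mu> ! i / a ! i"] r
      by (simp add: X_def)
    define Y where "Y = U * real_diag d (\<lambda>i. 1 / r i) * mat_adjoint U"
    have Y: "Y \<in> carrier_mat d d" using Uc by (simp add: Y_def)
    have "X * Y = 1\<^sub>m d" "Y * X = 1\<^sub>m d"
      unfolding X_def Y_def diagonalized_mult[OF U]
      by (rule diagonalized_one[OF U]; use r in \<open>fastforce simp: less_imp_neq\<close>)+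
    then have "invertible_mat X"
      using X Y by (auto simp: invertible_mat_def inverts_mat_def)
    moreover have "spectral_norm (mat_adjoint X * X - 1\<^sub>m d) \<le> \<delta>"
      unfolding XX
    proof (rule spectral_norm_diagonalized_le[OF U _ \<delta>(1)])
      fix i assume i: "i < d"
      have "1 - \<delta> \<le> \<mu> ! i / a ! i" "\<mu> ! i / a ! i \<le> 1 + \<delta>"
        using opt(6,7)[OF i] a_pos[OF i] by (simp_all add: pos_le_divide_eq pos_divide_le_eq)
      then show "\<bar>\<mu> ! i / a ! i - 1\<bar> \<le> \<delta>"
        by (simp add: abs_le_iff)
    qed
    moreover have "det (mat_adjoint X * X) = complex_of_real s"
    proof -
      have "(\<Prod>i<d. \<mu> ! i / a ! i) = s"
        using a_prod unfolding prod_dividef opt(8) by (simp del: prod_zero_iff)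
      then show ?thesis
        unfolding XX det_diagonalized[OF U] by (simp only:)
    qed
    ultimately have mem: "act X F \<in> perturbations d s \<delta> F"
      using X by (auto simp: perturbations_def)
    have "frame_op d (act X F) = U * real_diag d (\<lambda>i. \<mu> ! i) * mat_adjoint U"
    proof -
      have "frame_op d (act X F) = X * S * X"
        using frame_op_act[OF Fc X(1)] X(2) by (simp add: S_def)
      also have "\<dots> = U * real_diag d (\<lambda>i. r i * a ! i * r i) * mat_adjoint U"
        unfolding S_U X_def by (simp only: diagonalized_mult[OF U])
      also have "real_diag d (\<lambda>i. r i * a ! i * r i) = real_diag d (\<lambda>i. \<mu> ! i)"
      proof (rule real_diag_cong)
        fix i assume i: "i < d"
        have "r i * a ! i * r i = (r i * r i) * a ! i" by simp
        then show "r i * a ! i * r i = \<mu> ! i"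
          using r(2)[OF i] a_pos[OF i] by simp
      qed
      finally show ?thesis .
    qed
    then have "eigvals_desc (frame_op d (act X F)) = \<mu>"
      using eigvals_desc_diagonalized[OF U] map_nth_decr[OF \<mu>_len \<mu>_sorted] by metis
    then show ?thesis
      using mem X by blast
  qed

  have minimal: "(\<forall>k \<in> {1..d}. (\<Prod>i<k. \<mu> ! i) \<le> (\<Prod>i<k. eigvals_desc (frame_op d (act V F)) ! i)) \<and>
      (eigvals_desc (frame_op d (act V F)) = \<mu> \<longleftrightarrow> det (mat_adjoint V * V) = of_real s \<and>
        (\<exists>vs. orthonormal_basis d vs \<and>
           S = mat_sum d d (\<lambda>i. of_real (a ! i) \<cdot>\<^sub>m outer (vs ! i) (vs ! i)) \<and>
           mat_adjoint V * V = mat_sum d d (\<lambda>i. of_real (\<mu> ! i / a ! i) \<cdot>\<^sub>m outer (vs ! i) (vs ! i)))) \<and>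
      length (eigvals_desc (frame_op d (act V F))) = d"
    if V: "V \<in> carrier_mat d d" and mem: "act V F \<in> perturbations d s \<delta> F" for V
  proof -
    have "det (frame_op d F) \<noteq> 0"
      unfolding S_def[symmetric] det_S of_real_eq_0_iff using a_prod by (simp del: prod_zero_iff)
    note cond = perturbation_conditions[OF assms(1) V mem this]
    obtain B where B: "V * B = 1\<^sub>m d" "B * V = 1\<^sub>m d" "B \<in> carrier_mat d d"
    proof -
      obtain B where *: "inverts_mat V B" "inverts_mat B V"
        using cond(1) by (auto simp: invertible_mat_def)
      then have "V * B = 1\<^sub>m d" "B * V = 1\<^sub>m (dim_row B)"
        using V by (simp_all add: inverts_mat_def)
      moreover have "dim_col B = d" "dim_row B = d"
        using V arg_cong[OF calculation(1), of dim_col] arg_cong[OF calculation(2), of dim_col] by simp_all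
      ultimately show ?thesis
        using that by auto
    qed
    note bounds = perturbation_norm_bounds[OF V cond(2) \<delta>(1)]
    define H where "H = frame_op d (act V F)"
    define g where "g = eigvals_desc H"
    have H_eq: "H = V * S * mat_adjoint V"
      using frame_op_act[OF Fc V] by (simp add: H_def S_def)
    have "set (act V F) \<subseteq> carrier_vec d"
      using Fc V by (auto simp: act_def)
    then have H: "H \<in> carrier_mat d d" "mat_adjoint H = H"
      using frame_op_hermitian by (simp_all add: H_def)
    obtain ws where ws: "orthonormal_basis d ws"
      and H_ws: "H = mat_of_cols d ws * real_diag d (\<lambda>i. g ! i) * mat_adjoint (mat_of_cols d ws)"
      using hermitian_spectral_decomposition[OF H] by (auto simp: g_def)
    have g_len: "length g = d" and g_sorted: "decr g = g"
      using hermitian_spectral_decomposition[OF H] by (auto simp: g_def)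
    define W where "W = mat_of_cols d ws"
    have W: "unitary d W" and H_W: "H = W * real_diag d (\<lambda>i. g ! i) * mat_adjoint W"
      using unitary_orthonormal_basis[OF ws] H_ws by (simp_all add: W_def)
    have cong: "V * (U * real_diag d (\<lambda>i. a ! i) * mat_adjoint U) * mat_adjoint V =
        W * real_diag d (\<lambda>i. g ! i) * mat_adjoint W"
      using H_eq H_W S_U by simp
    have g_bounds: "(1 - \<delta>) * a ! i \<le> g ! i" "g ! i \<le> (1 + \<delta>) * a ! i" if "i < d" for i
      using congruence_eigenvalue_bounds[OF U W V B(3,1) cong bounds] that a_pos[OF that] \<delta>
        decr_nth[OF a_sorted a_len] decr_nth[OF g_sorted g_len] by simp_all
    have det_VV: "det (mat_adjoint V * V) = complex_of_real ((\<Prod>i<d. g ! i) / (\<Prod>i<d. a ! i))"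
    proof -
      have "complex_of_real (\<Prod>i<d. g ! i) = det H"
        unfolding H_W by (rule det_diagonalized[OF W, symmetric])
      also have "\<dots> = det (mat_adjoint V * V) * det S"
        using V S by (simp add: H_eq det_mult[of _ d])
      finally show ?thesis
        using a_prod by (simp add: det_S field_simps del: of_real_prod prod_zero_iff)
    qed
    have "s * (\<Prod>i<d. a ! i) \<le> (\<Prod>i<d. g ! i)"
      using cond(3) a_prod by (simp add: det_VV pos_le_divide_eq del: of_real_prod of_real_divide prod_zero_iff)
    then have ineq: "\<forall>k \<in> {1..d}. (\<Prod>i<k. \<mu> ! i) \<le> (\<Prod>i<k. g ! i)"
      using opt(10)[OF g_len g_sorted] g_bounds by simp
    have "g = \<mu> \<longleftrightarrow> det (mat_adjoint V * V) = of_real s \<and>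
        (\<exists>vs. orthonormal_basis d vs \<and>
           S = mat_sum d d (\<lambda>i. of_real (a ! i) \<cdot>\<^sub>m outer (vs ! i) (vs ! i)) \<and>
           mat_adjoint V * V = mat_sum d d (\<lambda>i. of_real (\<mu> ! i / a ! i) \<cdot>\<^sub>m outer (vs ! i) (vs ! i)))"
    proof (intro iffI conjI)
      assume g: "g = \<mu>"
      then show "det (mat_adjoint V * V) = of_real s"
        using opt(8) a_prod by (simp add: det_VV del: of_real_prod prod_zero_iff)
      obtain c where c: "\<forall>i<d. (c < \<mu> ! i \<longrightarrow> \<mu> ! i \<le> (1 - \<delta>) * a ! i) \<and>
          (\<mu> ! i < c \<longrightarrow> (1 + \<delta>) * a ! i \<le> \<mu> ! i)"
        using opt(9) by blast
      have "mat_adjoint V * V = U * real_diag d (\<lambda>i. \<mu> ! i / a ! i) * mat_adjoint U"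
        by (rule congruence_rigidity[OF U W V cong[unfolded g] bounds a_pos, where c = c]) (use c in auto)
      then show "\<exists>vs. orthonormal_basis d vs \<and>
           S = mat_sum d d (\<lambda>i. of_real (a ! i) \<cdot>\<^sub>m outer (vs ! i) (vs ! i)) \<and>
           mat_adjoint V * V = mat_sum d d (\<lambda>i. of_real (\<mu> ! i / a ! i) \<cdot>\<^sub>m outer (vs ! i) (vs ! i))"
        using us S_us unfolding U_def outer_form[OF us, symmetric] by blast
    next
      assume "det (mat_adjoint V * V) = of_real s \<and> (\<exists>vs. orthonormal_basis d vs \<and>
           S = mat_sum d d (\<lambda>i. of_real (a ! i) \<cdot>\<^sub>m outer (vs ! i) (vs ! i)) \<and>
           mat_adjoint V * V = mat_sum d d (\<lambda>i. of_real (\<mu> ! i / a ! i) \<cdot>\<^sub>m outer (vs ! i) (vs ! i)))"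
      then obtain vs where vs: "orthonormal_basis d vs"
        and S_vs: "S = mat_of_cols d vs * real_diag d (\<lambda>i. a ! i) * mat_adjoint (mat_of_cols d vs)"
        and P_vs: "mat_adjoint V * V =
          mat_of_cols d vs * real_diag d (\<lambda>i. \<mu> ! i / a ! i) * mat_adjoint (mat_of_cols d vs)"
        using outer_form by metis
      have U': "unitary d (mat_of_cols d vs)"
        by (rule unitary_orthonormal_basis[OF vs])
      have "real_diag d (\<lambda>i. a ! i * (\<mu> ! i / a ! i)) = real_diag d (\<lambda>i. \<mu> ! i)"
        proof (rule real_diag_cong)
        fix i assume "i < d"
        then show "a ! i * (\<mu> ! i / a ! i) = \<mu> ! i"
          using a_pos[of i] by simp
      qed
      then have SP: "S * (mat_adjoint V * V) =
          mat_of_cols d vs * real_diag d (\<lambda>i. \<mu> ! i) * mat_adjoint (mat_of_cols d vs)"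
        unfolding P_vs S_vs diagonalized_mult[OF U'] by simp
      \<comment> \<open>\<open>V S V\<^sup>*\<close> is similar to \<open>S (V\<^sup>* V)\<close>, which is diagonal in the basis \<open>vs\<close>.\<close>
      have "V * (S * (mat_adjoint V * V)) * B = V * S * mat_adjoint V * (V * B)"
        using V S B(3) by (simp add: assoc_mult_mat[of _ d d _ d _ d])
      also have "\<dots> = H"
        using V S B(1) by (simp add: H_eq)
      finally have "H = V * (S * (mat_adjoint V * V)) * B" ..
      then have "similar_mat_wit H (S * (mat_adjoint V * V)) V B"
        using V S(1) H(1) B by (intro similar_mat_witI[of _ _ d]) simp_all
      then have "similar_mat H (S * (mat_adjoint V * V))"
        by (auto simp: similar_mat_def)
      then have "g = eigvals_desc (S * (mat_adjoint V * V))"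
        unfolding g_def by (rule eigvals_desc_similar)
      then show "g = \<mu>"
        using eigvals_desc_diagonalized[OF U' SP] map_nth_decr[OF \<mu>_len \<mu>_sorted] by simp
    qed
    then show ?thesis
      using ineq g_len by (simp add: g_def H_def)
  qed
  have products: "(\<forall>k \<in> {1..d}. (\<Prod>i<k. \<mu> ! i) = (\<Prod>i<k. eigvals_desc (frame_op d (act V F)) ! i))
      \<longleftrightarrow> eigvals_desc (frame_op d (act V F)) = \<mu>"
    if "V \<in> carrier_mat d d" "act V F \<in> perturbations d s \<delta> F" for V
    using eq_iff_partial_products[OF \<mu>_len _ \<mu>_pos] minimal[OF that] by blast
  have "lam = decr lam" "sum_list lam \<le> t" "0 < \<epsilon>" "\<mu> = decr \<mu>"
    using opt(1-3) \<mu>_sorted by simp_all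
  then show ?thesis
    using attained minimal products unfolding a_def S_def by blast
qed

end
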